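(* Let $A=\{\pm e_1,\dots,\pm e_4\}\subset\mathbb{R}^4$, $I=[0,1]$, and let $A_{26}\subset\mathbb{R}^5$ consist of the points $\pm a_i=(\pm e_i,0)$, $\pm b_i=(\pm e_i,1)$ ($i=1,\dots,4$), $a_0=(0,0,0,0,0)$, $b_0=(0,0,0,0,1)$, and the eight points $c_{+,+,+,0}=(\tfrac12,\tfrac12,\tfrac12,0,\tfrac12)$, $c_{-,-,-,0}=(-\tfrac12,-\tfrac12,-\tfrac12,0,\tfrac12)$, $c_{+,-,0,-}=(\tfrac12,-\tfrac12,0,-\tfrac12,\tfrac12)$, $c_{-,+,0,+}=(-\tfrac12,\tfrac12,0,\tfrac12,\tfrac12)$, $c_{-,0,+,-}=(-\tfrac12,0,\tfrac12,-\tfrac12,\tfrac12)$, $c_{+,0,-,+}=(\tfrac12,0,-\tfrac12,\tfrac12,\tfrac12)$, $c_{0,+,-,-}=(0,\tfrac12,-\tfrac12,-\tfrac12,\tfrac12)$, $c_{0,-,+,+}=(0,-\tfrac12,\tfrac12,\tfrac12,\tfrac12)$. Let $\mathcal{A}_{26}\subset\mathbb{R}^6$ be the vector configuration consisting of $(p,1)$ for each of the 18 points $p=\pm a_i,\pm b_i,a_0,b_0$, and $(2c,2)$ for each of the eight points $c=c_{*,*,*,*}$ (e.g. $(1,1,1,0,1,2)$ for $c_{+,+,+,0}$). Let $\mathcal{K}$ consist of all vertices and edges of the cross-polytope $\mathrm{conv}(A)$ and of its triangles other than $\pm\{e_1,e_2,e_3\}$, $\pm\{e_1,-e_4,-e_2\}$,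 $\pm\{e_2,-e_4,-e_3\}$, $\pm\{e_3,-e_4,-e_1\}$. Orient the edges by $e_1\to e_2$, $e_2\to e_3$, $e_3\to e_1$, $-e_1\to-e_2$, $-e_2\to-e_3$, $-e_3\to-e_1$, $-e_2\to e_1$, $-e_3\to e_2$, $-e_1\to e_3$, $e_2\to-e_1$, $e_3\to-e_2$, $e_1\to-e_3$, $e_4\to e_i$, $-e_4\to-e_i$, $-e_i\to e_4$, $e_i\to-e_4$ ($i=1,2,3$), which is acyclic on each triangle of $\mathcal{K}$, and let $T$ be the triangulation of $\mathcal{K}\times I$ corresponding to this orientation. Then (1) $T$ can be extended to a triangulation of $A_{26}$, and (2) such an extension can be chosen which is unimodular when considered in $\mathcal{A}_{26}$.
   Context: For a simplicial complex $\mathcal{K}$ of faces of $\mathrm{conv}(A)$ with an orientation of its edges acyclic on each simplex, the corresponding triangulation of $\mathcal{K}\times I$ is: for each $F\in\mathcal{K}$ with vertices linearly ordered $v_1<\dots<v_k$ by the orientation ($v_i<v_j$ iff $v_i\to v_j$), triangulate $F\times I$ by the simplices $\{(v_1,0),\dots,(v_i,0),(v_i,1),\dots,(v_k,1)\}$, $i=1,\dots,k$. A triangulation of a point set $B$ is a geometric simplicial complex with vertices in $B$ covering $\mathrm{conv}(B)$; it extends $T$ if it contains $T$ as a subcomplex. A triangulation of $A_{26}$ is unimodular in $\mathcal{A}_{26}$ if, for every maximal simplex, the corresponding vectors of $\mathcal{A}_{26}$ form a basis of the lattice spanned by $\mathcal{A}_{26}$. *)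

theory Defs
  imports "HOL-Analysis.Analysis"
begin

section \<open>Triangulations of point sets and of prisms\<close>

text \<open>Cells are represented as convex sets, following \<^const>\<open>simplicial_complex\<close>. In particular a
  nonempty complex contains the empty face.\<close>

definition vertices :: "'a::real_vector set \<Rightarrow> 'a set"
  where "vertices S = {v. v extreme_point_of S}"

definition triangulation_of :: "'a::euclidean_space set \<Rightarrow> 'a set set \<Rightarrow> bool"
  where "triangulation_of B \<T> \<longleftrightarrow>
    simplicial_complex \<T> \<and> (\<forall>S\<in>\<T>. vertices S \<subseteq> B) \<and> \<Union>\<T> = convex hull B"

definition vertex_order :: "('a::real_vector \<times> 'a) set \<Rightarrow> 'a set \<Rightarrow> 'a list \<Rightarrow> bool"
  where "vertex_order E F vs \<longleftrightarrow>
    distinct vs \<and> set vs = vertices F \<and>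
    (\<forall>i<length vs. \<forall>j<length vs. i < j \<longleftrightarrow> (vs ! i, vs ! j) \<in> E)"

text \<open>The triangulation of \<open>\<K> \<times> [0,1]\<close> given by an orientation \<open>E\<close> of the edges of \<open>\<K>\<close>. The list
  \<open>vs\<close> is indexed from 0, so \<open>take (Suc i) vs\<close> is \<open>v\<^sub>1, \<dots>, v\<^sub>i\<^sub>+\<^sub>1\<close> and \<open>drop i vs\<close> is
  \<open>v\<^sub>i\<^sub>+\<^sub>1, \<dots>, v\<^sub>k\<close>. The listed simplices are closed under taking faces to obtain a complex.\<close>

definition prism_triangulation ::
    "'a::real_vector set set \<Rightarrow> ('a \<times> 'a) set \<Rightarrow> ('a \<times> real) set set"
  where "prism_triangulation \<K> E =
    {S. \<exists>F\<in>\<K>. \<exists>vs i. vertex_order E F vs \<and> i < length vs \<and>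
        S face_of convex hull ((\<lambda>v. (v, 0)) ` set (take (Suc i) vs) \<union>
                               (\<lambda>v. (v, 1)) ` set (drop i vs))}"


section \<open>Lattice bases and unimodularity\<close>

text \<open>The additive group of a real vector space as a \<open>\<int>\<close>-module.\<close>

definition int_scale :: "int \<Rightarrow> 'a::real_vector \<Rightarrow> 'a"
  where "int_scale n v = of_int n *\<^sub>R v"

lemma module_int_scale: "module int_scale"
  by unfold_locales (simp_all add: int_scale_def algebra_simps)

definition lattice_basis :: "'a::real_vector set \<Rightarrow> 'a set \<Rightarrow> bool"
  where "lattice_basis B V \<longleftrightarrow>
    \<not> module.dependent int_scale B \<and> module.span int_scale B = module.span int_scale V"

text \<open>\<open>f\<close> assigns to each point of \<open>B\<close> the corresponding vector of the configuration \<open>f ` B\<close>.\<close>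

definition unimodular_in :: "('a::real_vector \<Rightarrow> 'b::real_vector) \<Rightarrow> 'a set \<Rightarrow> 'a set set \<Rightarrow> bool"
  where "unimodular_in f B \<T> \<longleftrightarrow>
    (\<forall>S\<in>\<T>. (\<forall>S'\<in>\<T>. S \<subseteq> S' \<longrightarrow> S' = S) \<longrightarrow> lattice_basis (f ` vertices S) (f ` B))"


section \<open>The point set and the partial triangulation\<close>

text \<open>\<open>\<real>\<^sup>5\<close> is taken to be \<open>\<real>\<^sup>4 \<times> \<real>\<close>, and \<open>\<real>\<^sup>6\<close> to be \<open>\<real>\<^sup>5 \<times> \<real>\<close>.\<close>

definition ev :: "4 \<Rightarrow> real ^ 4"
  where "ev i = axis i 1"

definition A_cross :: "(real ^ 4) set"
  where "A_cross = range ev \<union> range (\<lambda>i. - ev i)"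

definition C8 :: "((real ^ 4) \<times> real) set"
  where "C8 =
   {(vector [ 1/2,  1/2,  1/2,    0], 1/2),
    (vector [-1/2, -1/2, -1/2,    0], 1/2),
    (vector [ 1/2, -1/2,    0, -1/2], 1/2),
    (vector [-1/2,  1/2,    0,  1/2], 1/2),
    (vector [-1/2,    0,  1/2, -1/2], 1/2),
    (vector [ 1/2,    0, -1/2,  1/2], 1/2),
    (vector [   0,  1/2, -1/2, -1/2], 1/2),
    (vector [   0, -1/2,  1/2,  1/2], 1/2)}"

definition A26 :: "((real ^ 4) \<times> real) set"
  where "A26 = A_cross \<times> {0, 1} \<union> {(0, 0), (0, 1)} \<union> C8"

text \<open>The bijection from the points of \<open>A26\<close> to the vectors of the configuration in \<open>\<real>\<^sup>6\<close>; the
  configuration itself is \<open>config_vec ` A26\<close>.\<close>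

definition config_vec :: "(real ^ 4) \<times> real \<Rightarrow> ((real ^ 4) \<times> real) \<times> real"
  where "config_vec p = (if p \<in> C8 then (2 *\<^sub>R p, 2) else (p, 1))"

definition removed_triangles :: "(real ^ 4) set set"
  where "removed_triangles =
    {{  ev 1,   ev 2,   ev 3}, {- ev 1, - ev 2, - ev 3},
     {  ev 1, - ev 4, - ev 2}, {- ev 1,   ev 4,   ev 2},
     {  ev 2, - ev 4, - ev 3}, {- ev 2,   ev 4,   ev 3},
     {  ev 3, - ev 4, - ev 1}, {- ev 3,   ev 4,   ev 1}}"

definition K_cross :: "(real ^ 4) set set"
  where "K_cross = {F. F face_of convex hull A_cross \<and> aff_dim F \<le> 2} - (hull) convex ` removed_triangles"

definition orientation :: "((real ^ 4) \<times> (real ^ 4)) set"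
  where "orientation =
    {(  ev 1,   ev 2), (  ev 2,   ev 3), (  ev 3,   ev 1),
     (- ev 1, - ev 2), (- ev 2, - ev 3), (- ev 3, - ev 1),
     (- ev 2,   ev 1), (- ev 3,   ev 2), (- ev 1,   ev 3),
     (  ev 2, - ev 1), (  ev 3, - ev 2), (  ev 1, - ev 3)} \<union>
    (\<Union>i\<in>{1, 2, 3}. {(ev 4, ev i), (- ev 4, - ev i), (- ev i, ev 4), (ev i, - ev 4)})"

definition T_prism :: "((real ^ 4) \<times> real) set set"
  where "T_prism = prism_triangulation K_cross orientation"


section \<open>The orientation is acyclic on every face in \<open>K_cross\<close>\<close>

text \<open>By \<open>ex_vertex_order\<close> below, every face in \<open>K_cross\<close> contributes its prism to \<open>T_prism\<close>.\<close>

lemma ev_eq [simp]: "ev i = ev j \<longleftrightarrow> i = j"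
  by (simp add: ev_def axis_eq_axis)

lemma ev_neq_minus [simp]: "ev i \<noteq> - ev j" "- ev j \<noteq> ev i"
proof -
  have "ev i $ i \<noteq> (- ev j) $ i"
    by (simp add: ev_def axis_def)
  then show "ev i \<noteq> - ev j" "- ev j \<noteq> ev i" by metis+
qed

lemma A_cross_eq: "A_cross = {ev 1, ev 2, ev 3, ev 4, - ev 1, - ev 2, - ev 3, - ev 4}"
proof -
  have "(UNIV :: 4 set) = {1, 2, 3, 4}" using exhaust_4 by auto
  then show ?thesis by (auto simp: A_cross_def)
qed

lemma orientation_iff:
  "(ev 1, v) \<in> orientation \<longleftrightarrow> v = ev 2 \<or> v = - ev 3 \<or> v = - ev 4"
  "(ev 2, v) \<in> orientation \<longleftrightarrow> v = ev 3 \<or> v = - ev 1 \<or> v = - ev 4"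
  "(ev 3, v) \<in> orientation \<longleftrightarrow> v = ev 1 \<or> v = - ev 2 \<or> v = - ev 4"
  "(ev 4, v) \<in> orientation \<longleftrightarrow> v = ev 1 \<or> v = ev 2 \<or> v = ev 3"
  "(- ev 1, v) \<in> orientation \<longleftrightarrow> v = - ev 2 \<or> v = ev 3 \<or> v = ev 4"
  "(- ev 2, v) \<in> orientation \<longleftrightarrow> v = - ev 3 \<or> v = ev 1 \<or> v = ev 4"
  "(- ev 3, v) \<in> orientation \<longleftrightarrow> v = - ev 1 \<or> v = ev 2 \<or> v = ev 4"
  "(- ev 4, v) \<in> orientation \<longleftrightarrow> v = - ev 1 \<or> v = - ev 2 \<or> v = - ev 3"
  by (auto simp: orientation_def)

lemma orientation_total:
  assumes "u \<in> A_cross" "v \<in> A_cross" "u \<noteq> v" "u \<noteq> - v"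
  shows "(u, v) \<in> orientation \<longleftrightarrow> (v, u) \<notin> orientation"
  using assms unfolding A_cross_eq by (elim insertE emptyE; simp add: orientation_iff)

lemma orientation_irrefl: "(u, u) \<notin> orientation"
  by (auto simp: orientation_def)

lemma orientation_cyclic:
  assumes uv: "(u, v) \<in> orientation" and vw: "(v, w) \<in> orientation" and wu: "(w, u) \<in> orientation"
  shows "{u, v, w} \<in> removed_triangles"
proof -
  have "u \<in> {ev 1, ev 2, ev 3, ev 4, - ev 1, - ev 2, - ev 3, - ev 4}"
    using uv by (auto simp: orientation_def)
  then show ?thesis
    using uv vw wu
    apply (simp only: insert_iff empty_iff simp_thms)
    apply (elim disjE; hypsubst; simp only: orientation_iff)
           apply (elim disjE; hypsubst; simp only: orientation_iff; elim disjE; hypsubst;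
        simp add: orientation_iff; simp add: removed_triangles_def insert_commute)+
    done
qed

lemma proper_face_no_antipodes:
  assumes F: "F face_of convex hull A_cross" "aff_dim F \<le> 2" and v: "v \<in> F" "- v \<in> F"
  shows False
proof -
  have "convex F" using F(1) face_of_imp_convex by blast
  then have "(1/2) *\<^sub>R v + (1/2) *\<^sub>R (- v) \<in> F"
    by (intro convexD v) auto
  then have 0: "0 \<in> F" by simp
  have A: "u \<in> F" if "u \<in> A_cross" for u
  proof -
    have "u \<noteq> 0" "- u \<in> A_cross"
      using that by (auto simp: A_cross_def ev_def axis_eq_0_iff)
    have "u \<noteq> - u"
    proof
      assume "u = - u"
      then have "u + u = 0" using eq_neg_iff_add_eq_0 by blast
      then have "2 *\<^sub>R u = 0" by (simp only: scaleR_2)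
      with \<open>u \<noteq> 0\<close> show False by simp
    qed
    then have "(0::real^4) \<in> open_segment u (- u)"
      unfolding in_segment by (intro conjI exI[of _ "1/2"]) simp_all
    moreover have "u \<in> convex hull A_cross" "- u \<in> convex hull A_cross"
      using that \<open>- u \<in> A_cross\<close> by (auto intro: hull_inc)
    ultimately show ?thesis using face_ofD[OF F(1)] 0 by blast
  qed
  have "Basis \<subseteq> F"
    using A by (auto simp: Basis_vec_def A_cross_def ev_def)
  then have "span F = UNIV"
    by (metis span_Basis span_mono top.extremum_uniqueI)
  moreover have "affine hull F = span F"
    using 0 by (simp add: affine_hull_span_0 hull_inc)
  ultimately have "aff_dim F = 4"
    using aff_dim_eq_full[of F] by simp
  with F(2) show False by simp
qed

lemma card_vertices_K_cross:
  assumes F: "F \<in> K_cross"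
  shows "vertices F \<subseteq> A_cross" "finite (vertices F)" "card (vertices F) \<le> 3"
    "\<And>u v. u \<in> vertices F \<Longrightarrow> v \<in> vertices F \<Longrightarrow> u \<noteq> - v"
    "vertices F \<notin> removed_triangles"
proof -
  have F': "F face_of convex hull A_cross" "aff_dim F \<le> 2" "F \<notin> (hull) convex ` removed_triangles"
    using F by (auto simp: K_cross_def)
  have finA: "finite A_cross" by (simp add: A_cross_eq)
  show sub: "vertices F \<subseteq> A_cross"
    using extreme_point_of_face[OF F'(1)] extreme_point_of_convex_hull by (auto simp: vertices_def)
  then show fin: "finite (vertices F)" using finA finite_subset by blast
  have VF: "vertices F \<subseteq> F" by (auto simp: vertices_def extreme_point_of_def)
  show anti: "u \<noteq> - v" if "u \<in> vertices F" "v \<in> vertices F" for u v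
    using proper_face_no_antipodes[OF F'(1,2), of v] that VF by auto
  have "pairwise orthogonal (vertices F)"
    unfolding pairwise_def
  proof (intro ballI impI)
    fix u v assume *: "u \<in> vertices F" "v \<in> vertices F" "u \<noteq> v"
    then have "u \<in> A_cross" "v \<in> A_cross" "u \<noteq> - v" using sub anti by auto
    with \<open>u \<noteq> v\<close> show "orthogonal u v"
      by (auto simp: A_cross_def ev_def orthogonal_def inner_axis_axis)
  qed
  moreover have "0 \<notin> vertices F"
    using sub by (auto simp: A_cross_def ev_def axis_eq_0_iff)
  ultimately have "independent (vertices F)"
    by (rule pairwise_orthogonal_independent)
  then have "\<not> affine_dependent (vertices F)"
    using affine_dependent_imp_dependent by blast
  then have "int (card (vertices F)) = aff_dim (vertices F) + 1"
    by (rule aff_dim_affine_independent)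
  also have "\<dots> \<le> 3" using aff_dim_subset[OF VF] F'(2) by linarith
  finally show "card (vertices F) \<le> 3" by simp
  have "compact F"
    using face_of_imp_compact[OF convex_convex_hull _ F'(1)] finA
    by (simp add: finite_imp_compact_convex_hull)
  moreover have "convex F" using F'(1) face_of_imp_convex by blast
  ultimately have "F = convex hull vertices F"
    unfolding vertices_def by (rule Krein_Milman_Minkowski)
  then show "vertices F \<notin> removed_triangles" using F'(3) by blast
qed

lemma ex_vertex_order:
  assumes F: "F \<in> K_cross"
  shows "\<exists>vs. vertex_order orientation F vs"
proof -
  note V = card_vertices_K_cross[OF F]
  have tot: "(u, v) \<in> orientation \<longleftrightarrow> (v, u) \<notin> orientation"
    if "u \<in> vertices F" "v \<in> vertices F" "u \<noteq> v" for u v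
    using that V orientation_total by blast
  from V(3) consider "card (vertices F) = 0" | "card (vertices F) = 1"
    | "card (vertices F) = 2" | "card (vertices F) = 3" by linarith
  then show ?thesis
  proof cases
    case 1
    then have "vertex_order orientation F []" using V(2) by (simp add: vertex_order_def)
    then show ?thesis ..
  next
    case 2
    then obtain u where "vertices F = {u}" by (auto simp: card_1_singleton_iff)
    then have "vertex_order orientation F [u]"
      by (simp add: vertex_order_def orientation_irrefl)
    then show ?thesis ..
  next
    case 3
    then obtain u v where uv: "vertices F = {u, v}" "u \<noteq> v" by (auto simp: card_2_iff)
    have *: "vertex_order orientation F [x, y]"
      if "{x, y} = {u, v}" "(x, y) \<in> orientation" for x y
      using that uv tot[of x y] orientation_irrefl
      by (auto simp: vertex_order_def less_Suc_eq nth_Cons split: nat.split)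
    show ?thesis using *[of u v] *[of v u] tot[of u v] uv by auto
  next
    case 4
    then obtain u v w where uvw: "vertices F = {u, v, w}" "u \<noteq> v" "v \<noteq> w" "u \<noteq> w"
      by (auto simp: card_3_iff)
    have *: "vertex_order orientation F [x, y, z]"
      if "{x, y, z} = {u, v, w}" "x \<noteq> y" "y \<noteq> z" "x \<noteq> z"
        "(x, y) \<in> orientation" "(y, z) \<in> orientation" "(x, z) \<in> orientation" for x y z
    proof -
      have "(y, x) \<notin> orientation" "(z, y) \<notin> orientation" "(z, x) \<notin> orientation"
        using that tot[of x y] tot[of y z] tot[of x z] uvw(1) by blast+
      with that uvw(1) orientation_irrefl show ?thesis
        by (simp add: vertex_order_def All_less_Suc)
    qed
    have "\<not> ((u, v) \<in> orientation \<and> (v, w) \<in> orientation \<and> (w, u) \<in> orientation)"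
      "\<not> ((u, w) \<in> orientation \<and> (w, v) \<in> orientation \<and> (v, u) \<in> orientation)"
      using orientation_cyclic[of u v w] orientation_cyclic[of u w v] V(5) uvw(1)
      by (auto simp: insert_commute)
    moreover have "(u, v) \<in> orientation \<longleftrightarrow> (v, u) \<notin> orientation"
      "(v, w) \<in> orientation \<longleftrightarrow> (w, v) \<notin> orientation"
      "(u, w) \<in> orientation \<longleftrightarrow> (w, u) \<notin> orientation"
      using tot[of u v] tot[of v w] tot[of u w] uvw by simp_all
    moreover have "{u, w, v} = {u, v, w}" "{v, u, w} = {u, v, w}" "{v, w, u} = {u, v, w}"
      "{w, u, v} = {u, v, w}" "{w, v, u} = {u, v, w}"
      by blast+
    ultimately show ?thesis
      using *[of u v w] *[of u w v] *[of v u w] *[of v w u] *[of w u v] *[of w v u] uvw(2-4)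
      by metis
  qed
qed

end

theory Submission
  imports Defs
begin

text \<open>Call an orthant of \<open>\<real>\<^sup>4\<close> together with the removed triangle \<open>{u\<^sub>1, u\<^sub>2, u\<^sub>3}\<close> in its cross-polytope
  facet \<open>{u\<^sub>1, u\<^sub>2, u\<^sub>3, w}\<close> (there is exactly one) a frame, and let \<open>c\<close> be the corresponding point of \<open>C8\<close>. If
  \<open>p = x\<^sub>1 u\<^sub>1 + x\<^sub>2 u\<^sub>2 + x\<^sub>3 u\<^sub>3 + y w\<close> lies in that orthant, then \<open>(p, t)\<close> lies in the convex hull of \<open>A26\<close> iff
  \<open>0 \<le> t \<le> 1\<close> and \<open>x\<^sub>1 + x\<^sub>2 + x\<^sub>3 + y - g \<le> 1\<close> for \<open>g = min {x\<^sub>1, x\<^sub>2, x\<^sub>3, t, 1 - t}\<close>. Splitting off the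
  point \<open>c\<close> with weight \<open>2 g\<close> leaves a point in the cone over the bottom, over the top, or over a prism
  \<open>F \<times> [0,1]\<close> with \<open>F\<close> a triangle of \<open>K_cross\<close>. In the last case the standard prism triangulation of
  the join of \<open>0\<close> and \<open>F\<close> applies, where \<open>0\<close> precedes all vertices of \<open>F\<close>. The cells obtained in
  this way form the triangulation. All weights are determined by the point, which makes the cells a
  geometric complex, and every cell is a lattice basis.\<close>

section \<open>Simplicial complexes from unique convex representations\<close>

text \<open>In \<open>unique_rep\<close> the common total of the weights is arbitrary, so it also
  covers differences of representations. With \<open>S = S'\<close> it yields affine independence,
  with different simplices it yields proper intersections.\<close>

locale geometric_complex =
  fixes A :: "'a::euclidean_space set" and D :: "'a set set"
  assumes finite_A: "finite A"
    and simplex_subset: "S \<in> D \<Longrightarrow> S \<subseteq> A"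
    and down_closed: "S \<in> D \<Longrightarrow> T \<subseteq> S \<Longrightarrow> T \<in> D"
    and unique_rep: "\<lbrakk>S \<in> D; S' \<in> D; \<And>v. 0 \<le> l v; \<And>v. 0 \<le> m v; \<And>v. v \<notin> S \<Longrightarrow> l v = 0;
      \<And>v. v \<notin> S' \<Longrightarrow> m v = 0; sum l A = sum m A; (\<Sum>v\<in>A. l v *\<^sub>R v) = (\<Sum>v\<in>A. m v *\<^sub>R v); v \<in> A\<rbrakk>
      \<Longrightarrow> l v = m v"
begin

lemma finite_simplex: "S \<in> D \<Longrightarrow> finite S"
  using finite_A simplex_subset finite_subset by blast

lemma sum_extend:
  fixes u :: "'a \<Rightarrow> 'b::real_vector"
  assumes "S \<in> D"
  shows "(\<Sum>v\<in>A. if v \<in> S then u v else 0) = sum u S"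
  using sum.inter_restrict[OF finite_A, of u S] simplex_subset[OF assms]
  by (simp add: Int_absorb1)

lemma sum_extend_scaleR:
  assumes "S \<in> D"
  shows "(\<Sum>v\<in>A. (if v \<in> S then u v else 0) *\<^sub>R v) = (\<Sum>v\<in>S. u v *\<^sub>R v)"
  using sum_extend[OF assms, of "\<lambda>v. u v *\<^sub>R v"] by (simp add: if_distrib[of "\<lambda>r. r *\<^sub>R _"] cong: if_cong)

lemma unique_rep_simplices:
  assumes S: "S \<in> D" "S' \<in> D" and u: "\<forall>v\<in>S. 0 \<le> u v" "\<forall>v\<in>S'. 0 \<le> u' v" "sum u S = sum u' S'"
    "(\<Sum>v\<in>S. u v *\<^sub>R v) = (\<Sum>v\<in>S'. u' v *\<^sub>R v)" and v: "v \<in> A"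
  shows "(if v \<in> S then u v else 0) = (if v \<in> S' then u' v else 0)"
  by (rule unique_rep[of S S' "\<lambda>v. if v \<in> S then u v else 0" "\<lambda>v. if v \<in> S' then u' v else 0"])
    (use S u v in \<open>auto simp: sum_extend sum_extend_scaleR\<close>)

text \<open>The positive and negative parts of an affine dependency are two representations of one
  point on the same simplex with equal totals, so they coincide and the dependency vanishes.\<close>

lemma affine_independent_simplex:
  assumes S: "S \<in> D"
  shows "\<not> affine_dependent S"
proof
  assume "affine_dependent S"
  then obtain U x where U: "sum U S = 0" "x \<in> S" "U x \<noteq> 0" "(\<Sum>v\<in>S. U v *\<^sub>R v) = 0"
    using affine_dependent_explicit_finite[OF finite_simplex[OF S]] by auto
  have U_eq: "U v = max 0 (U v) - max 0 (- U v)" for v by linarith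
  have "(if x \<in> S then max 0 (U x) else 0) = (if x \<in> S then max 0 (- U x) else 0)"
  proof (rule unique_rep_simplices[OF S S])
    have "sum U S = (\<Sum>v\<in>S. max 0 (U v)) - (\<Sum>v\<in>S. max 0 (- U v))"
      by (simp add: sum_subtractf[symmetric] U_eq[symmetric])
    with U(1) show "(\<Sum>v\<in>S. max 0 (U v)) = (\<Sum>v\<in>S. max 0 (- U v))" by simp
    have "(\<Sum>v\<in>S. U v *\<^sub>R v) = (\<Sum>v\<in>S. max 0 (U v) *\<^sub>R v) - (\<Sum>v\<in>S. max 0 (- U v) *\<^sub>R v)"
      by (simp add: sum_subtractf[symmetric] scaleR_diff_left[symmetric] U_eq[symmetric])
    with U(4) show "(\<Sum>v\<in>S. max 0 (U v) *\<^sub>R v) = (\<Sum>v\<in>S. max 0 (- U v) *\<^sub>R v)" by simp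
    show "x \<in> A" using U(2) S simplex_subset by blast
  qed auto
  with U(2,3) show False by (auto simp: max_def split: if_splits)
qed

text \<open>The two representations of a common point agree, so both are supported on the shared
  vertices.\<close>

lemma convex_hull_Int_simplices:
  assumes S: "S \<in> D" and S': "S' \<in> D"
  shows "convex hull S \<inter> convex hull S' = convex hull (S \<inter> S')"
proof
  show "convex hull S \<inter> convex hull S' \<subseteq> convex hull (S \<inter> S')"
  proof
    fix x assume x: "x \<in> convex hull S \<inter> convex hull S'"
    then obtain u where u: "\<forall>v\<in>S. 0 \<le> u v" "sum u S = 1" "(\<Sum>v\<in>S. u v *\<^sub>R v) = x"
      using convex_hull_finite[OF finite_simplex[OF S]] by auto
    obtain u' where u': "\<forall>v\<in>S'. 0 \<le> u' v" "sum u' S' = 1" "(\<Sum>v\<in>S'. u' v *\<^sub>R v) = x"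
      using x convex_hull_finite[OF finite_simplex[OF S']] by auto
    have 0: "u v = 0" if "v \<in> S - S'" for v
      using unique_rep_simplices[OF S S' u(1) u'(1), of v] u u' that simplex_subset[OF S] by auto
    have "sum u (S \<inter> S') = 1" "(\<Sum>v\<in>S \<inter> S'. u v *\<^sub>R v) = x"
      using u 0 finite_simplex[OF S]
      by (subst sum.mono_neutral_left[of S "S \<inter> S'"]; auto)+
    then show "x \<in> convex hull (S \<inter> S')"
      using u(1) finite_simplex[OF S] by (subst convex_hull_finite) auto
  qed
  show "convex hull (S \<inter> S') \<subseteq> convex hull S \<inter> convex hull S'"
    by (simp add: hull_mono)
qed

lemma simplicial_complex_simplices: "simplicial_complex ((hull) convex ` D)"
  unfolding simplicial_complex_def
proof (intro conjI ballI allI impI)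
  have "D \<subseteq> Pow A" using simplex_subset by blast
  then show "finite ((hull) convex ` D)"
    using finite_A finite_subset by blast
next
  fix S assume "S \<in> (hull) convex ` D"
  then show "\<exists>n. n simplex S"
    \<comment> \<open>The dimension is the number of vertices minus 1, hence -1 for the empty
      face.\<close>
    unfolding simplex_def using affine_independent_simplex
    by (metis (no_types, opaque_lifting) diff_add_cancel imageE)
next
  fix F S assume "S \<in> (hull) convex ` D \<and> F face_of S"
  then obtain S0 where "S0 \<in> D" "F face_of convex hull S0" by blast
  then show "F \<in> (hull) convex ` D"
    using face_of_convex_hull_affine_independent[OF affine_independent_simplex]
      down_closed by blast
next
  fix S S' assume "S \<in> (hull) convex ` D \<and> S' \<in> (hull) convex ` D"
  then obtain S0 S0' where S: "S0 \<in> D" "S0' \<in> D" "S = convex hull S0" "S' = convex hull S0'"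
    by blast
  have "convex hull (S0 \<inter> S0') face_of convex hull S0"
    using face_of_convex_hull_affine_independent[OF affine_independent_simplex[OF S(1)]] by blast
  then show "S \<inter> S' face_of S"
    using S convex_hull_Int_simplices by simp
qed

lemma vertices_convex_hull_simplex: "S \<in> D \<Longrightarrow> vertices (convex hull S) = S"
  by (simp add: vertices_def affine_independent_simplex
      extreme_point_of_convex_hull_affine_independent)

text \<open>All weights of the barycenter are positive, so by uniqueness every vertex of
  \<open>S\<close> carries positive weight in \<open>M\<close>. This later places each face in a
  maximal cell.\<close>

lemma simplex_subset_if_barycenter:
  assumes S: "S \<in> D" "S \<noteq> {}" and M: "M \<in> D"
    and bary: "(\<Sum>v\<in>S. (1 / card S) *\<^sub>R v) \<in> convex hull M"
  shows "S \<subseteq> M"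
proof
  fix x assume x: "x \<in> S"
  have card: "0 < card S" using S finite_simplex card_gt_0_iff by blast
  obtain u where u: "\<forall>v\<in>M. 0 \<le> u v" "sum u M = 1"
    "(\<Sum>v\<in>M. u v *\<^sub>R v) = (\<Sum>v\<in>S. (1 / card S) *\<^sub>R v)"
    using bary convex_hull_finite[OF finite_simplex[OF M]] by auto
  have "(if x \<in> S then 1 / card S else 0) = (if x \<in> M then u x else 0)"
    by (rule unique_rep_simplices[OF S(1) M])
      (use u card x simplex_subset[OF S(1)] in auto)
  then show "x \<in> M" using x card by (auto split: if_splits)
qed

end

section \<open>Frames\<close>

lemma uminus_mem_A_cross: "v \<in> A_cross \<Longrightarrow> - v \<in> A_cross"
  by (auto simp: A_cross_def)

lemma inner_A_cross:
  assumes "u \<in> A_cross" "v \<in> A_cross"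
  shows "u \<bullet> v = (if u = v then 1 else if u = - v then - 1 else 0)"
  using assms by (auto simp: A_cross_def inner_axis_axis ev_def axis_eq_axis)

lemma A_cross_ne_zero: "v \<in> A_cross \<Longrightarrow> v \<noteq> 0"
  by (auto simp: A_cross_def ev_def axis_eq_0_iff)

lemma orientation_in_A_cross: "(u, v) \<in> orientation \<Longrightarrow> u \<in> A_cross \<and> v \<in> A_cross"
  by (auto simp: orientation_def A_cross_eq)

lemma orientation_asym:
  assumes "(u, v) \<in> orientation"
  shows "(v, u) \<notin> orientation" "u \<noteq> v" "u \<noteq> - v"
proof -
  have "u \<in> A_cross" using assms orientation_in_A_cross by blast
  then show "(v, u) \<notin> orientation" "u \<noteq> v" "u \<noteq> - v"
    using assms unfolding A_cross_eq
    by (elim insertE emptyE; hypsubst; auto simp: orientation_iff)+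
qed

text \<open>The removed triangles are exactly the directed 3-cycles of the orientation. This
  description treats all eight uniformly and leaves the starting vertex free.\<close>

definition cyclic_triangle :: "real ^ 4 \<Rightarrow> real ^ 4 \<Rightarrow> real ^ 4 \<Rightarrow> bool"
  where "cyclic_triangle u1 u2 u3 \<longleftrightarrow>
    (u1, u2) \<in> orientation \<and> (u2, u3) \<in> orientation \<and> (u3, u1) \<in> orientation"

lemma vector_4:
  "(vector [a, b, c, d] :: 'a::zero ^ 4) $ 1 = a"
  "(vector [a, b, c, d] :: 'a ^ 4) $ 2 = b"
  "(vector [a, b, c, d] :: 'a ^ 4) $ 3 = c"
  "(vector [a, b, c, d] :: 'a ^ 4) $ 4 = d"
  unfolding vector_def by simp_all

lemma sum_cyclic_triangle:
  "cyclic_triangle u1 u2 u3 \<Longrightarrow> \<Sum>{u1, u2, u3} = u1 + u2 + u3"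
  using orientation_asym(2)[of u1 u2] orientation_asym(2)[of u2 u3] orientation_asym(2)[of u3 u1]
  by (simp add: cyclic_triangle_def add.assoc)

lemma cyclic_triangleD:
  assumes "cyclic_triangle v1 v2 v3"
  shows "v1 \<in> A_cross" "v2 \<in> A_cross" "v3 \<in> A_cross" "v1 \<noteq> v2" "v2 \<noteq> v3" "v1 \<noteq> v3"
    "v1 \<noteq> - v2" "v2 \<noteq> - v3" "v3 \<noteq> - v1" "v2 \<noteq> - v1" "v3 \<noteq> - v2" "v1 \<noteq> - v3"
  using assms orientation_in_A_cross orientation_asym[of v1 v2] orientation_asym[of v2 v3]
    orientation_asym[of v3 v1]
  by (simp_all add: cyclic_triangle_def) (metis minus_minus)+

lemma C8_eq: "C8 = (\<lambda>G. ((1/2) *\<^sub>R \<Sum>G, 1/2)) ` removed_triangles"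
proof -
  \<comment> \<open>\<open>C8\<close> and \<open>removed_triangles\<close> list their last two
    antipodal pairs in opposite orders; this permutes them before coordinates are compared.\<close>
  have *: "{(x1, r), (x2, r), (x3, r), (x4, r), (x5, r), (x6, r), (x7, r), (x8, r)} =
      {(y1, r), (y2, r), (y3, r), (y4, r), (y5, r), (y6, r), (y7, r), (y8, r)}"
    if "x1 = y1" "x2 = y2" "x3 = y3" "x4 = y4" "x5 = y7" "x6 = y8" "x7 = y5" "x8 = y6"
    for x1 x2 x3 x4 x5 x6 x7 x8 y1 y2 y3 y4 y5 y6 y7 y8 :: "real ^ 4" and r :: real
    using that by auto
  show ?thesis
    unfolding C8_def removed_triangles_def image_insert image_empty
    by (rule *; simp add: vec_eq_iff forall_4 vector_4 ev_def axis_def)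
qed

lemma center_mem_C8:
  assumes "cyclic_triangle u1 u2 u3"
  shows "((1/2) *\<^sub>R (u1 + u2 + u3), 1/2) \<in> C8"
proof -
  have "{u1, u2, u3} \<in> removed_triangles"
    using orientation_cyclic assms by (auto simp: cyclic_triangle_def)
  moreover have "\<Sum>{u1, u2, u3} = u1 + u2 + u3"
    using assms by (rule sum_cyclic_triangle)
  ultimately show ?thesis
    unfolding C8_eq by (metis (no_types, lifting) imageI)
qed

lemma C8_center:
  assumes "c \<in> C8"
  obtains u1 u2 u3 where "cyclic_triangle u1 u2 u3" "c = ((1/2) *\<^sub>R (u1 + u2 + u3), 1/2)"
proof -
  obtain G where G: "G \<in> removed_triangles" "c = ((1/2) *\<^sub>R \<Sum>G, 1/2)"
    using assms unfolding C8_eq by blast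
  have "\<exists>u1 u2 u3. cyclic_triangle u1 u2 u3 \<and> G = {u1, u2, u3}"
    using G(1) unfolding removed_triangles_def cyclic_triangle_def
    by (elim insertE emptyE; hypsubst) (rule exI, rule exI, rule exI, rule conjI[rotated],
      rule refl, simp add: orientation_iff)+
  then obtain u1 u2 u3 where u: "cyclic_triangle u1 u2 u3" "G = {u1, u2, u3}" by blast
  then have "\<Sum>G = u1 + u2 + u3" by (simp add: sum_cyclic_triangle)
  with u G(2) that show thesis by simp
qed

text \<open>Any two distinct removed triangles contain a pair of antipodal vertices, so a coordinate
  hyperplane separates their centers. This is checked on all pairs.\<close>

lemma C8_opposite_coordinate:
  assumes "c \<in> C8" "c' \<in> C8" "c \<noteq> c'"
  obtains g where "g \<in> A_cross" "0 < fst c \<bullet> g" "fst c' \<bullet> g < 0"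
proof -
  have "\<exists>i. fst c $ i * fst c' $ i < 0"
  proof (rule ccontr)
    assume "\<nexists>i. fst c $ i * fst c' $ i < 0"
    then have "\<forall>i. \<not> fst c $ i * fst c' $ i < 0" by blast
    then show False
      using assms unfolding C8_def forall_4
      by (elim insertE emptyE; hypsubst; simp add: vector_4)
  qed
  then obtain i where "0 < fst c $ i \<and> fst c' $ i < 0 \<or> fst c $ i < 0 \<and> 0 < fst c' $ i"
    by (auto simp: mult_less_0_iff)
  then show thesis
    using that[of "ev i"] that[of "- ev i"] by (auto simp: A_cross_def ev_def inner_axis)
qed

lemma fst_C8_inner:
  assumes "c \<in> C8" "g \<in> A_cross"
  shows "fst c \<bullet> g \<in> {- 1/2, 0, 1/2}"
proof -
  obtain u1 u2 u3 where u: "cyclic_triangle u1 u2 u3" "c = ((1/2) *\<^sub>R (u1 + u2 + u3), 1/2)"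
    using C8_center[OF assms(1)] .
  show ?thesis
    using cyclic_triangleD[OF u(1)] u(2) assms(2) by (auto simp: inner_add_left inner_A_cross)
qed

definition frame :: "real ^ 4 \<Rightarrow> real ^ 4 \<Rightarrow> real ^ 4 \<Rightarrow> real ^ 4 \<Rightarrow> bool"
  where "frame u1 u2 u3 w \<longleftrightarrow>
    cyclic_triangle u1 u2 u3 \<and> w \<in> A_cross - {u1, u2, u3, - u1, - u2, - u3}"

lemma frame_rotate: "frame u1 u2 u3 w \<Longrightarrow> frame u2 u3 u1 w"
  by (auto simp: frame_def cyclic_triangle_def)

lemma ex_frame:
  obtains u1 u2 u3 w where "frame u1 u2 u3 w"
    "0 \<le> p \<bullet> u1" "0 \<le> p \<bullet> u2" "0 \<le> p \<bullet> u3" "0 \<le> p \<bullet> w"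
proof -
  note * = that
  \<comment> \<open>One frame for each of the sixteen sign patterns.\<close>
  have F: "frame (ev 1) (ev 2) (ev 3) (ev 4)" "frame (ev 1) (ev 2) (ev 3) (- ev 4)"
    "frame (- ev 1) (- ev 2) (- ev 3) (ev 4)" "frame (- ev 1) (- ev 2) (- ev 3) (- ev 4)"
    "frame (ev 1) (- ev 4) (- ev 2) (ev 3)" "frame (ev 1) (- ev 4) (- ev 2) (- ev 3)"
    "frame (- ev 1) (ev 4) (ev 2) (ev 3)" "frame (- ev 1) (ev 4) (ev 2) (- ev 3)"
    "frame (ev 2) (- ev 4) (- ev 3) (ev 1)" "frame (ev 2) (- ev 4) (- ev 3) (- ev 1)"
    "frame (- ev 2) (ev 4) (ev 3) (ev 1)" "frame (- ev 2) (ev 4) (ev 3) (- ev 1)"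
    "frame (ev 3) (- ev 4) (- ev 1) (ev 2)" "frame (ev 3) (- ev 4) (- ev 1) (- ev 2)"
    "frame (- ev 3) (ev 4) (ev 1) (ev 2)" "frame (- ev 3) (ev 4) (ev 1) (- ev 2)"
    by (simp_all add: frame_def cyclic_triangle_def orientation_iff A_cross_eq)
  have "0 \<le> p \<bullet> v \<or> 0 \<le> p \<bullet> (- v)" for v
    by auto
  from this[of "ev 1"] this[of "ev 2"] this[of "ev 3"] this[of "ev 4"]
  show thesis
    using *[OF F(1)] *[OF F(2)] *[OF F(3)] *[OF F(4)]
    *[OF F(5)] *[OF F(6)] *[OF F(7)] *[OF F(8)]
    *[OF F(9)] *[OF F(10)] *[OF F(11)] *[OF F(12)]
    *[OF F(13)] *[OF F(14)] *[OF F(15)] *[OF F(16)]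
    by argo
qed

context
  fixes u1 u2 u3 w :: "real ^ 4"
  assumes frame: "frame u1 u2 u3 w"
begin

lemma frame_in_A_cross: "u1 \<in> A_cross" "u2 \<in> A_cross" "u3 \<in> A_cross" "w \<in> A_cross"
  using frame orientation_in_A_cross by (auto simp: frame_def cyclic_triangle_def)

lemma frame_distinct:
  "u1 \<noteq> u2" "u2 \<noteq> u3" "u1 \<noteq> u3" "w \<noteq> u1" "w \<noteq> u2" "w \<noteq> u3"
  "u1 \<noteq> - u2" "u2 \<noteq> - u3" "u1 \<noteq> - u3" "w \<noteq> - u1" "w \<noteq> - u2" "w \<noteq> - u3"
  using frame orientation_asym[of u1 u2] orientation_asym[of u2 u3] orientation_asym[of u3 u1]
  by (simp_all add: frame_def cyclic_triangle_def) (metis minus_minus)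

lemma frame_inner: "u1 \<bullet> u1 = 1" "u2 \<bullet> u2 = 1" "u3 \<bullet> u3 = 1" "w \<bullet> w = 1"
  "u1 \<bullet> u2 = 0" "u1 \<bullet> u3 = 0" "u2 \<bullet> u3 = 0" "w \<bullet> u1 = 0" "w \<bullet> u2 = 0" "w \<bullet> u3 = 0"
  "u2 \<bullet> u1 = 0" "u3 \<bullet> u1 = 0" "u3 \<bullet> u2 = 0" "u1 \<bullet> w = 0" "u2 \<bullet> w = 0" "u3 \<bullet> w = 0"
  using frame_distinct frame_in_A_cross by (auto simp: inner_A_cross)

text \<open>Consequently the other three triangles of the facet are acyclic, and \<open>w\<close> is
  the first or the last vertex of each.\<close>

lemma frame_source_or_sink:
  "{(w, u1), (w, u2), (w, u3)} \<subseteq> orientation \<or> {(u1, w), (u2, w), (u3, w)} \<subseteq> orientation"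
proof -
  have "(\<forall>u\<in>G. (w, u) \<in> orientation) \<or> (\<forall>u\<in>G. (u, w) \<in> orientation)"
    if G: "G \<in> removed_triangles" "\<forall>u\<in>G. w \<noteq> u \<and> w \<noteq> - u" for G
    using frame_in_A_cross(4) G unfolding A_cross_eq removed_triangles_def
    by (elim insertE emptyE; hypsubst; simp add: orientation_iff)
  from this[of "{u1, u2, u3}"] show ?thesis
    using frame frame_distinct orientation_cyclic[of u1 u2 u3]
    by (simp add: frame_def cyclic_triangle_def)
qed

lemma A_cross_frame: "A_cross = {u1, u2, u3, w, - u1, - u2, - u3, - w}"
proof -
  have self: "v \<noteq> - v" if "v \<in> A_cross" for v
    using that inner_A_cross[OF that that] inner_A_cross[OF that uminus_mem_A_cross[OF that]] by auto
  have "u2 \<noteq> - u1" "u3 \<noteq> - u2" "u3 \<noteq> - u1" "u1 \<noteq> - w" "u2 \<noteq> - w" "u3 \<noteq> - w"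
    using frame_distinct(7-12) by (metis minus_minus)+
  then have "distinct [u1, u2, u3, w, - u1, - u2, - u3, - w]"
    using frame_distinct frame_distinct(4-6)[THEN not_sym] self[OF frame_in_A_cross(1)]
      self[OF frame_in_A_cross(2)] self[OF frame_in_A_cross(3)] self[OF frame_in_A_cross(4)]
    by simp
  from distinct_card[OF this] have "card {u1, u2, u3, w, - u1, - u2, - u3, - w} = 8" by simp
  moreover have "card A_cross = 8" unfolding A_cross_eq by simp
  moreover have "{u1, u2, u3, w, - u1, - u2, - u3, - w} \<subseteq> A_cross"
    using frame_in_A_cross uminus_mem_A_cross by blast
  ultimately show ?thesis
    by (metis A_cross_eq card_subset_eq finite.emptyI finite_insert)
qed

lemma frame_expansion:
  "p = (p \<bullet> u1) *\<^sub>R u1 + (p \<bullet> u2) *\<^sub>R u2 + (p \<bullet> u3) *\<^sub>R u3 + (p \<bullet> w) *\<^sub>R w"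
proof -
  let ?d = "p - ((p \<bullet> u1) *\<^sub>R u1 + (p \<bullet> u2) *\<^sub>R u2 + (p \<bullet> u3) *\<^sub>R u3 + (p \<bullet> w) *\<^sub>R w)"
  have "?d \<bullet> v = 0" if "v \<in> A_cross" for v
    using that unfolding A_cross_frame
    by (elim insertE emptyE; hypsubst) (simp_all add: inner_diff_left inner_add_left frame_inner)
  moreover have "ev i \<in> A_cross" for i by (simp add: A_cross_def)
  ultimately have "?d $ i = 0" for i
    unfolding cart_eq_inner_axis ev_def[symmetric] by blast
  then have "?d = 0" unfolding vec_eq_iff zero_index by blast
  then show ?thesis by simp
qed

text \<open>The positive vertices of a center form a directed 3-cycle. It would have to run through
  \<open>u1\<close>, \<open>u2\<close>, \<open>w\<close>, but \<open>w\<close> is a source or a sink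
  there.\<close>

lemma no_cyclic_in_frame_face:
  assumes "c \<in> C8" "\<And>v. v \<in> A_cross \<Longrightarrow> 0 < fst c \<bullet> v \<Longrightarrow> v \<in> {u1, u2, w}"
  shows False
proof -
  obtain v1 v2 v3 where v: "cyclic_triangle v1 v2 v3" "c = ((1/2) *\<^sub>R (v1 + v2 + v3), 1/2)"
    using C8_center[OF assms(1)] .
  note vA = cyclic_triangleD[OF v(1)]
  then have "v1 \<in> {u1, u2, w}" "v2 \<in> {u1, u2, w}" "v3 \<in> {u1, u2, w}"
    by (intro assms(2); simp add: v(2) inner_add_left inner_A_cross)+
  moreover have "(u1, u2) \<in> orientation" "(u2, u1) \<notin> orientation"
    using frame orientation_asym by (auto simp: frame_def cyclic_triangle_def)
  moreover have "{(w, u1), (w, u2)} \<subseteq> orientation \<and> (u1, w) \<notin> orientation \<and> (u2, w) \<notin> orientation \<or>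
      {(u1, w), (u2, w)} \<subseteq> orientation \<and> (w, u1) \<notin> orientation \<and> (w, u2) \<notin> orientation"
    using frame_source_or_sink orientation_asym(1) by blast
  ultimately show False
    using v(1) vA(4-6) unfolding cyclic_triangle_def by (elim insertE emptyE; hypsubst; simp)
qed

end

text \<open>A cyclic rotation of the frame moves the smallest coordinate to \<open>u3\<close>.
  Subtracting \<open>x3\<close> times \<open>u1 + u2 + u3\<close> then leaves a point in the cone
  over \<open>{u1, u2, w}\<close>.\<close>

lemma ex_frame_min:
  obtains u1 u2 u3 w x1 x2 x3 y where "frame u1 u2 u3 w"
    "p = x1 *\<^sub>R u1 + x2 *\<^sub>R u2 + x3 *\<^sub>R u3 + y *\<^sub>R w" "0 \<le> x3" "x3 \<le> x1" "x3 \<le> x2" "0 \<le> y"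
proof -
  obtain u1 u2 u3 w where *: "frame u1 u2 u3 w"
    "0 \<le> p \<bullet> u1" "0 \<le> p \<bullet> u2" "0 \<le> p \<bullet> u3" "0 \<le> p \<bullet> w"
    by (rule ex_frame)
  have r: "frame u2 u3 u1 w" "frame u3 u1 u2 w"
    using *(1) frame_rotate by blast+
  consider "p \<bullet> u3 \<le> p \<bullet> u1" "p \<bullet> u3 \<le> p \<bullet> u2" | "p \<bullet> u1 \<le> p \<bullet> u2" "p \<bullet> u1 \<le> p \<bullet> u3"
    | "p \<bullet> u2 \<le> p \<bullet> u3" "p \<bullet> u2 \<le> p \<bullet> u1"
    by linarith
  then show thesis
  proof cases
    case 1
    then show ?thesis using * by (intro that[OF *(1) frame_expansion[OF *(1)]])
  next
    case 2
    then show ?thesis using * by (intro that[OF r(1) frame_expansion[OF r(1)]])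
  next
    case 3
    then show ?thesis using * by (intro that[OF r(2) frame_expansion[OF r(2)]])
  qed
qed

section \<open>Uniqueness of representations\<close>

definition V0 :: "(real ^ 4) set"
  where "V0 = insert 0 A_cross"

text \<open>The orientation has directed cycles, so this relation is not an order on
  \<open>V0\<close>; the exchange argument rests on its asymmetry alone.\<close>

definition order0 :: "((real ^ 4) \<times> (real ^ 4)) set"
  where "order0 = orientation \<union> {0} \<times> A_cross"

definition lifted :: "((real ^ 4) \<times> real) set \<Rightarrow> real ^ 4 \<Rightarrow> bool"
  where "lifted S v \<longleftrightarrow> (v, 0) \<in> S \<or> (v, 1) \<in> S"

text \<open>The vertex sets of the faces of the triangulation. The last condition says that all three
  vertices of a removed triangle are only used on a single level.\<close>

definition faces26 :: "((real ^ 4) \<times> real) set set"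
  where "faces26 = {S. S \<subseteq> A26 \<and>
    (\<forall>c\<in>S \<inter> C8. \<forall>c'\<in>S \<inter> C8. c = c') \<and>
    (\<forall>v\<in>A_cross. lifted S v \<longrightarrow> \<not> lifted S (- v)) \<and>
    (\<forall>c\<in>S \<inter> C8. \<forall>v\<in>A_cross. lifted S v \<longrightarrow> 0 \<le> fst c \<bullet> v) \<and>
    (\<forall>u\<in>V0. \<forall>v\<in>V0. (u, 0) \<in> S \<longrightarrow> (v, 1) \<in> S \<longrightarrow> u \<noteq> v \<longrightarrow> (u, v) \<in> order0) \<and>
    (\<forall>c\<in>C8. (\<forall>v\<in>A_cross. 0 < fst c \<bullet> v \<longrightarrow> lifted S v) \<longrightarrow>
      (\<forall>v\<in>V0. (v, 0) \<notin> S) \<or> (\<forall>v\<in>V0. (v, 1) \<notin> S))}"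

lemma faces26D:
  assumes "S \<in> faces26"
  shows "S \<subseteq> A26"
    and "\<lbrakk>c \<in> S; c \<in> C8; c' \<in> S; c' \<in> C8\<rbrakk> \<Longrightarrow> c = c'"
    and "\<lbrakk>v \<in> A_cross; lifted S v\<rbrakk> \<Longrightarrow> \<not> lifted S (- v)"
    and "\<lbrakk>c \<in> S; c \<in> C8; v \<in> A_cross; lifted S v\<rbrakk> \<Longrightarrow> 0 \<le> fst c \<bullet> v"
    and "\<lbrakk>u \<in> V0; v \<in> V0; (u, 0) \<in> S; (v, 1) \<in> S; u \<noteq> v\<rbrakk> \<Longrightarrow> (u, v) \<in> order0"
    and "\<lbrakk>c \<in> C8; \<And>v. v \<in> A_cross \<Longrightarrow> 0 < fst c \<bullet> v \<Longrightarrow> lifted S v\<rbrakk> \<Longrightarrow>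
      (\<forall>v\<in>V0. (v, 0) \<notin> S) \<or> (\<forall>v\<in>V0. (v, 1) \<notin> S)"
proof -
  note d = assms[unfolded faces26_def mem_Collect_eq]
  note d1 = d[THEN conjunct1] and d2 = d[THEN conjunct2, THEN conjunct1]
  note d = d[THEN conjunct2, THEN conjunct2]
  note d3 = d[THEN conjunct1] and d4 = d[THEN conjunct2, THEN conjunct1]
  note d = d[THEN conjunct2, THEN conjunct2]
  note d5 = d[THEN conjunct1] and d6 = d[THEN conjunct2]
  show "S \<subseteq> A26" by (rule d1)
  show "c = c'" if "c \<in> S" "c \<in> C8" "c' \<in> S" "c' \<in> C8" using d2 that by blast
  show "\<not> lifted S (- v)" if "v \<in> A_cross" "lifted S v" using d3 that by blast
  show "0 \<le> fst c \<bullet> v" if "c \<in> S" "c \<in> C8" "v \<in> A_cross" "lifted S v" using d4 that by blast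
  show "(u, v) \<in> order0" if "u \<in> V0" "v \<in> V0" "(u, 0) \<in> S" "(v, 1) \<in> S" "u \<noteq> v" using d5 that by blast
  show "(\<forall>v\<in>V0. (v, 0) \<notin> S) \<or> (\<forall>v\<in>V0. (v, 1) \<notin> S)"
    if "c \<in> C8" "\<And>v. v \<in> A_cross \<Longrightarrow> 0 < fst c \<bullet> v \<Longrightarrow> lifted S v" using d6 that by blast
qed

lemma faces26I:
  assumes "S \<subseteq> A26"
    and "\<And>c c'. \<lbrakk>c \<in> S; c \<in> C8; c' \<in> S; c' \<in> C8\<rbrakk> \<Longrightarrow> c = c'"
    and "\<And>v. \<lbrakk>v \<in> A_cross; lifted S v\<rbrakk> \<Longrightarrow> \<not> lifted S (- v)"
    and "\<And>c v. \<lbrakk>c \<in> S; c \<in> C8; v \<in> A_cross; lifted S v\<rbrakk> \<Longrightarrow> 0 \<le> fst c \<bullet> v"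
    and "\<And>u v. \<lbrakk>u \<in> V0; v \<in> V0; (u, 0) \<in> S; (v, 1) \<in> S; u \<noteq> v\<rbrakk> \<Longrightarrow> (u, v) \<in> order0"
    and "\<And>c. \<lbrakk>c \<in> C8; \<And>v. v \<in> A_cross \<Longrightarrow> 0 < fst c \<bullet> v \<Longrightarrow> lifted S v\<rbrakk> \<Longrightarrow>
      (\<forall>v\<in>V0. (v, 0) \<notin> S) \<or> (\<forall>v\<in>V0. (v, 1) \<notin> S)"
  shows "S \<in> faces26"
  unfolding faces26_def by (intro CollectI conjI ballI impI) (use assms in \<open>blast+\<close>)

lemma lifted_mono: "T \<subseteq> S \<Longrightarrow> lifted T v \<Longrightarrow> lifted S v"
  by (auto simp: lifted_def)

lemma faces26_down_closed:
  assumes "S \<in> faces26" "T \<subseteq> S"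
  shows "T \<in> faces26"
proof (rule faces26I)
  note d = faces26D[OF assms(1)]
  show "T \<subseteq> A26" using d(1) assms(2) by blast
  show "c = c'" if "c \<in> T" "c \<in> C8" "c' \<in> T" "c' \<in> C8" for c c'
    using d(2) assms(2) that by blast
  show "\<not> lifted T (- v)" if "v \<in> A_cross" "lifted T v" for v
    using d(3) assms(2) that lifted_mono by blast
  show "0 \<le> fst c \<bullet> v" if "c \<in> T" "c \<in> C8" "v \<in> A_cross" "lifted T v" for c v
    using d(4) assms(2) that lifted_mono by blast
  show "(u, v) \<in> order0" if "u \<in> V0" "v \<in> V0" "(u, 0) \<in> T" "(v, 1) \<in> T" "u \<noteq> v" for u v
    using d(5) assms(2) that by blast
  show "(\<forall>v\<in>V0. (v, 0) \<notin> T) \<or> (\<forall>v\<in>V0. (v, 1) \<notin> T)"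
    if "c \<in> C8" "\<And>v. v \<in> A_cross \<Longrightarrow> 0 < fst c \<bullet> v \<Longrightarrow> lifted T v" for c
    using d(6)[OF that(1)] assms(2) that(2) lifted_mono by blast
qed

lemma order0_asym: "(u, v) \<in> order0 \<Longrightarrow> (v, u) \<notin> order0"
  using orientation_asym(1)[of u v] orientation_in_A_cross[of u v] orientation_in_A_cross[of v u]
    A_cross_ne_zero[of 0] by (auto simp: order0_def)

lemma finite_A_cross: "finite A_cross" and finite_V0: "finite V0" and finite_C8: "finite C8"
  by (simp_all add: A_cross_eq V0_def C8_def)

lemma snd_C8: "c \<in> C8 \<Longrightarrow> snd c = 1/2"
  by (auto simp: C8_def)

lemma not_C8 [simp]: "(v, 0) \<notin> C8" "(v, 1) \<notin> C8"
  using snd_C8[of "(v, 0)"] snd_C8[of "(v, 1)"] by auto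

lemma A26_eq: "A26 = (\<lambda>v. (v, 0)) ` V0 \<union> ((\<lambda>v. (v, 1)) ` V0 \<union> C8)"
  by (auto simp: A26_def V0_def)

lemma finite_A26: "finite A26"
  by (simp add: A26_eq finite_V0 finite_C8)

lemma sum_A26:
  fixes F :: "(real ^ 4) \<times> real \<Rightarrow> 'b::comm_monoid_add"
  shows "sum F A26 = (\<Sum>v\<in>V0. F (v, 0)) + ((\<Sum>v\<in>V0. F (v, 1)) + sum F C8)"
proof -
  have "sum F A26 = sum F ((\<lambda>v. (v, 0)) ` V0) + sum F ((\<lambda>v. (v, 1)) ` V0 \<union> C8)"
    unfolding A26_eq
    by (intro sum.union_disjoint) (auto simp: finite_V0 finite_C8)
  also have "sum F ((\<lambda>v. (v, 1)) ` V0 \<union> C8) = sum F ((\<lambda>v. (v, 1)) ` V0) + sum F C8"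
    by (intro sum.union_disjoint) (auto simp: finite_V0 finite_C8)
  finally show ?thesis by (simp add: sum.reindex inj_on_def)
qed

section \<open>Coordinates and heights of weighted sums of configuration vectors\<close>

lemma config_vec_simps:
  "config_vec (v, 0) = ((v, 0), 1)" "config_vec (v, 1) = ((v, 1), 1)"
  "c \<in> C8 \<Longrightarrow> config_vec c = (2 *\<^sub>R c, 2)"
  by (auto simp: config_vec_def)

lemma sum_inner_A_cross:
  fixes n :: "real ^ 4 \<Rightarrow> real"
  assumes g: "g \<in> A_cross"
  shows "(\<Sum>v\<in>V0. n v * (v \<bullet> g)) = n g - n (- g)"
proof -
  have "g \<noteq> - g"
    using inner_A_cross[OF g g] inner_A_cross[OF g uminus_mem_A_cross[OF g]] by auto
  have "(\<Sum>v\<in>V0. n v * (v \<bullet> g)) = (\<Sum>v\<in>A_cross. n v * (v \<bullet> g))"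
    unfolding V0_def using finite_A_cross by (intro sum.mono_neutral_right) auto
  also have "\<dots> = (\<Sum>v\<in>{g, - g}. n v * (v \<bullet> g))"
    using g uminus_mem_A_cross[OF g] inner_A_cross[OF _ g] finite_A_cross
    by (intro sum.mono_neutral_right) auto
  also have "\<dots> = n g - n (- g)"
    using \<open>g \<noteq> - g\<close> g inner_A_cross[OF g g] by simp
  finally show ?thesis .
qed

text \<open>Weighting the configuration vectors instead of the points serves two purposes: up to
  rescaling the weights of centers it records convex combinations, and it also records linear
  relations in the lattice.\<close>

definition config_sum :: "((real ^ 4) \<times> real \<Rightarrow> real) \<Rightarrow> ((real ^ 4) \<times> real) \<times> real"
  where "config_sum l = (\<Sum>s\<in>A26. l s *\<^sub>R config_vec s)"

lemma config_sum_inner: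
  assumes g: "g \<in> A_cross"
  shows "fst (fst (config_sum l)) \<bullet> g =
    (l (g, 0) + l (g, 1)) - (l (- g, 0) + l (- g, 1)) + 2 * (\<Sum>c\<in>C8. l c * (fst c \<bullet> g))"
proof -
  have "fst (fst (config_sum l)) \<bullet> g = (\<Sum>s\<in>A26. l s * (fst (fst (config_vec s)) \<bullet> g))"
    by (simp add: config_sum_def fst_sum inner_sum_left)
  also have "\<dots> = (\<Sum>v\<in>V0. l (v, 0) * (v \<bullet> g)) + ((\<Sum>v\<in>V0. l (v, 1) * (v \<bullet> g)) +
      (\<Sum>c\<in>C8. 2 * (l c * (fst c \<bullet> g))))"
    unfolding sum_A26 by (simp add: config_vec_simps mult.left_commute cong: sum.cong)
  also have "\<dots> = (l (g, 0) + l (g, 1)) - (l (- g, 0) + l (- g, 1)) + 2 * (\<Sum>c\<in>C8. l c * (fst c \<bullet> g))"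
    by (simp add: sum_inner_A_cross[OF g, of "\<lambda>v. l (v, _)"] sum_distrib_left)
  finally show ?thesis .
qed

text \<open>The second quantity is the depth below the top level. A vector \<open>(2c, 2)\<close> of
  a center contributes 1 to both height and depth, which makes the two levels symmetric.\<close>

lemma config_sum_height:
  "snd (fst (config_sum l)) = (\<Sum>v\<in>V0. l (v, 1)) + sum l C8"
  "snd (config_sum l) - snd (fst (config_sum l)) = (\<Sum>v\<in>V0. l (v, 0)) + sum l C8"
proof -
  have "snd (fst (config_sum l)) = (\<Sum>s\<in>A26. l s * snd (fst (config_vec s)))"
    by (simp add: config_sum_def fst_sum snd_sum)
  also have "\<dots> = (\<Sum>v\<in>V0. l (v, 1)) + sum l C8"
    unfolding sum_A26 by (simp add: config_vec_simps snd_C8 cong: sum.cong)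
  finally show 1: "snd (fst (config_sum l)) = (\<Sum>v\<in>V0. l (v, 1)) + sum l C8" .
  have "snd (config_sum l) = (\<Sum>s\<in>A26. l s * snd (config_vec s))"
    by (simp add: config_sum_def snd_sum)
  also have "\<dots> = (\<Sum>v\<in>V0. l (v, 0)) + ((\<Sum>v\<in>V0. l (v, 1)) + 2 * sum l C8)"
    unfolding sum_A26 by (simp add: config_vec_simps sum_distrib_right mult.commute[of 2] cong: sum.cong)
  finally show "snd (config_sum l) - snd (fst (config_sum l)) = (\<Sum>v\<in>V0. l (v, 0)) + sum l C8"
    using 1 by simp
qed

context
  fixes S :: "((real ^ 4) \<times> real) set" and l :: "(real ^ 4) \<times> real \<Rightarrow> real"
  assumes S: "S \<in> faces26" and nonneg: "\<And>s. 0 \<le> l s" and supp: "\<And>s. s \<notin> S \<Longrightarrow> l s = 0"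
begin

lemma sum_C8_single:
  fixes F :: "(real ^ 4) \<times> real \<Rightarrow> real"
  assumes "c \<in> S" "c \<in> C8"
  shows "(\<Sum>c'\<in>C8. l c' * F c') = l c * F c"
proof -
  have "l c' = 0" if "c' \<in> C8 - {c}" for c'
    using faces26D(2)[OF S] supp assms that by blast
  then have "(\<Sum>c'\<in>C8. l c' * F c') = (\<Sum>c'\<in>{c}. l c' * F c')"
    using assms finite_C8 by (intro sum.mono_neutral_right) auto
  then show ?thesis by simp
qed

lemma not_lifted_weight: "\<not> lifted S v \<Longrightarrow> l (v, 0) + l (v, 1) = 0"
  using supp by (simp add: lifted_def)

text \<open>The coordinate 1/2 of \<open>c\<close> is doubled in the configuration, and
  \<open>- g\<close> cannot be lifted because it pairs negatively with \<open>c\<close>.\<close>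

lemma config_sum_inner_C8:
  assumes c: "c \<in> S" "c \<in> C8" and g: "g \<in> A_cross" "0 < fst c \<bullet> g"
  shows "fst (fst (config_sum l)) \<bullet> g = l (g, 0) + l (g, 1) + l c"
proof -
  have "fst c \<bullet> g = 1/2" using fst_C8_inner[OF c(2) g(1)] g(2) by auto
  moreover have "\<not> lifted S (- g)"
    using faces26D(4)[OF S c uminus_mem_A_cross[OF g(1)]] g(2) by auto
  ultimately show ?thesis
    using config_sum_inner[OF g(1), of l] sum_C8_single[OF c, of "\<lambda>c. fst c \<bullet> g"]
      not_lifted_weight[of "- g"] by simp
qed

text \<open>The next two lemmas together say that the weight of \<open>c\<close> is the minimum of certain linear
  functions of the represented point, truncated at 0, hence determined by it.\<close>

lemma C8_weight_lower:
  assumes c: "c \<in> C8" "0 < l c"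
  shows "g \<in> A_cross \<Longrightarrow> 0 < fst c \<bullet> g \<Longrightarrow> l c \<le> fst (fst (config_sum l)) \<bullet> g"
    "l c \<le> snd (fst (config_sum l))" "l c \<le> snd (config_sum l) - snd (fst (config_sum l))"
proof -
  have cS: "c \<in> S" using c(2) supp[of c] by auto
  show "l c \<le> fst (fst (config_sum l)) \<bullet> g" if "g \<in> A_cross" "0 < fst c \<bullet> g"
    using config_sum_inner_C8[OF cS c(1) that] nonneg[of "(g, 0)"] nonneg[of "(g, 1)"] by simp
  show "l c \<le> snd (fst (config_sum l))" "l c \<le> snd (config_sum l) - snd (fst (config_sum l))"
    using config_sum_height[of l] sum_C8_single[OF cS c(1), of "\<lambda>_. 1"]
      sum_nonneg[of V0 "\<lambda>v. l (v, 0)"] sum_nonneg[of V0 "\<lambda>v. l (v, 1)"] nonneg by simp_all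
qed

lemma C8_weight_upper:
  assumes c: "c \<in> C8"
  shows "(\<exists>g\<in>A_cross. 0 < fst c \<bullet> g \<and> fst (fst (config_sum l)) \<bullet> g \<le> l c) \<or>
    snd (fst (config_sum l)) \<le> l c \<or> snd (config_sum l) - snd (fst (config_sum l)) \<le> l c"
proof (rule ccontr)
  assume contra: "\<not> ?thesis"
  then have g: "l c < fst (fst (config_sum l)) \<bullet> g" if "g \<in> A_cross" "0 < fst c \<bullet> g" for g
    using that by force
  have t: "l c < snd (fst (config_sum l))" "l c < snd (config_sum l) - snd (fst (config_sum l))"
    using contra by auto
  consider c' where "c' \<in> S" "c' \<in> C8" "c' \<noteq> c" | "c \<in> S" | "S \<inter> C8 = {}" by blast
  then show False
  proof cases
    case 1
    \<comment> \<open>A different center in \<open>S\<close> is negative along some \<open>h\<close>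
      on which \<open>c\<close> is positive. It keeps \<open>h\<close> from being lifted, so the
      coordinate along \<open>h\<close> is at most 0.\<close>
    obtain h where h: "h \<in> A_cross" "0 < fst c \<bullet> h" "fst c' \<bullet> h < 0"
      using C8_opposite_coordinate[OF c 1(2)] 1(3) by metis
    have "\<not> lifted S h"
      using faces26D(4)[OF S 1(1,2) h(1)] h(3) by auto
    then have "fst (fst (config_sum l)) \<bullet> h = - (l (- h, 0) + l (- h, 1)) + 2 * (l c' * (fst c' \<bullet> h))"
      using config_sum_inner[OF h(1), of l] sum_C8_single[OF 1(1,2), of "\<lambda>c. fst c \<bullet> h"]
        not_lifted_weight[of h] by simp
    also have "\<dots> \<le> 0"
      using nonneg[of "(- h, 0)"] nonneg[of "(- h, 1)"] h(3) nonneg[of c']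
        mult_nonneg_nonpos[of "l c'" "fst c' \<bullet> h"] by simp
    finally show False using g[OF h(1,2)] nonneg[of c] by simp
  next
    case 2
    \<comment> \<open>Strict excess along every \<open>g\<close> forces the whole triangle of
      \<open>c\<close> to be lifted. The last condition on \<open>S\<close> then empties one level,
      and the height or depth on that side is just \<open>l c\<close>.\<close>
    have "lifted S g" if "g \<in> A_cross" "0 < fst c \<bullet> g" for g
      using g[OF that] config_sum_inner_C8[OF 2 c that] not_lifted_weight[of g] by force
    then have "(\<forall>v\<in>V0. (v, 0) \<notin> S) \<or> (\<forall>v\<in>V0. (v, 1) \<notin> S)"
      by (rule faces26D(6)[OF S c])
    then have "(\<Sum>v\<in>V0. l (v, 0)) = 0 \<or> (\<Sum>v\<in>V0. l (v, 1)) = 0"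
      using supp by (auto intro!: sum.neutral)
    then show False
      using t config_sum_height[of l] sum_C8_single[OF 2 c, of "\<lambda>_. 1"] by auto
  next
    case 3
    then have 0: "l c' = 0" if "c' \<in> C8" for c' using that supp by blast
    then have C8: "sum l C8 = 0" "(\<Sum>c\<in>C8. l c * (fst c \<bullet> g)) = 0" for g by simp_all
    \<comment> \<open>The same argument without a center: now \<open>l c\<close> is 0, and so is the
      height or the depth.\<close>
    have "lifted S g" if "g \<in> A_cross" "0 < fst c \<bullet> g" for g
      using g[OF that] config_sum_inner[OF that(1), of l] not_lifted_weight[of g] C8
        nonneg[of c] nonneg[of "(- g, 0)"] nonneg[of "(- g, 1)"] by force
    then have "(\<forall>v\<in>V0. (v, 0) \<notin> S) \<or> (\<forall>v\<in>V0. (v, 1) \<notin> S)"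
      by (rule faces26D(6)[OF S c])
    then have "(\<Sum>v\<in>V0. l (v, 0)) = 0 \<or> (\<Sum>v\<in>V0. l (v, 1)) = 0"
      using supp by (auto intro!: sum.neutral)
    then show False
      using t config_sum_height[of l] C8(1) 0[OF c] by auto
  qed
qed

end

text \<open>If \<open>l c\<close> is positive, it is at most every quantity in the minimum, while
  \<open>m c\<close> is at least one of them; if it is 0, nonnegativity of \<open>m c\<close>
  suffices. Exchanging the roles gives equality.\<close>

lemma C8_weight_unique:
  assumes "S \<in> faces26" "\<And>s. 0 \<le> l s" "\<And>s. s \<notin> S \<Longrightarrow> l s = 0"
    and "S' \<in> faces26" "\<And>s. 0 \<le> m s" "\<And>s. s \<notin> S' \<Longrightarrow> m s = 0"
    and eq: "config_sum l = config_sum m" and c: "c \<in> C8"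
  shows "l c = m c"
proof -
  note l = assms(1-3) and m = assms(4-6)
  have "l c \<le> m c"
    using C8_weight_upper[OF m c] C8_weight_lower[OF l c] eq assms(5)[of c] by force
  moreover have "m c \<le> l c"
    using C8_weight_upper[OF l c] C8_weight_lower[OF m c] eq assms(2)[of c] by force
  ultimately show ?thesis by simp
qed

text \<open>Exchange argument: if both the totals over each pair \<open>(v, 0)\<close>, \<open>(v, 1)\<close> and the total height
  agree but some weights differ, then two vertices would precede each other.\<close>

lemma config_sum_unique:
  assumes S: "S \<in> faces26" "\<And>s. 0 \<le> l s" "\<And>s. s \<notin> S \<Longrightarrow> l s = 0"
    and S': "S' \<in> faces26" "\<And>s. 0 \<le> m s" "\<And>s. s \<notin> S' \<Longrightarrow> m s = 0"
    and eq: "config_sum l = config_sum m" and s: "s \<in> A26"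
  shows "l s = m s"
proof -
  have C8: "l c = m c" if "c \<in> C8" for c
    using C8_weight_unique[OF S S' eq that] .
  have C8_sum: "sum l C8 = sum m C8" "(\<Sum>c\<in>C8. l c * (fst c \<bullet> g)) = (\<Sum>c\<in>C8. m c * (fst c \<bullet> g))" for g
    using C8 by (auto intro: sum.cong)
  \<comment> \<open>The coordinate along \<open>v\<close> gives only the difference of the totals
    over \<open>v\<close> and \<open>- v\<close>. In each representation one of these nonnegative
    totals is 0, so the difference determines both.\<close>
  have nA: "l (v, 0) + l (v, 1) = m (v, 0) + m (v, 1)" if v: "v \<in> A_cross" for v
  proof -
    have anti: "\<not> lifted S v \<or> \<not> lifted S (- v)" "\<not> lifted S' v \<or> \<not> lifted S' (- v)"
      using faces26D(3)[OF S(1) v] faces26D(3)[OF S'(1) v] by blast+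
    have "(l (v, 0) + l (v, 1)) - (l (- v, 0) + l (- v, 1)) =
        (m (v, 0) + m (v, 1)) - (m (- v, 0) + m (- v, 1))"
      using config_sum_inner[OF v, of l] config_sum_inner[OF v, of m] eq C8_sum(2)[of v] by simp
    moreover have "l (v, 0) + l (v, 1) = 0 \<or> l (- v, 0) + l (- v, 1) = 0"
      "m (v, 0) + m (v, 1) = 0 \<or> m (- v, 0) + m (- v, 1) = 0"
      using anti S(3) S'(3) unfolding lifted_def by auto
    ultimately show ?thesis
      using S(2)[of "(v, 0)"] S(2)[of "(v, 1)"] S(2)[of "(- v, 0)"] S(2)[of "(- v, 1)"]
        S'(2)[of "(v, 0)"] S'(2)[of "(v, 1)"] S'(2)[of "(- v, 0)"] S'(2)[of "(- v, 1)"]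
      by linarith
  qed
  have sum1: "(\<Sum>v\<in>V0. l (v, 1)) = (\<Sum>v\<in>V0. m (v, 1))" and
    sum0: "(\<Sum>v\<in>V0. l (v, 0)) = (\<Sum>v\<in>V0. m (v, 0))"
    using config_sum_height[of l] config_sum_height[of m] eq C8_sum(1) by simp_all
  have n: "l (v, 0) + l (v, 1) = m (v, 0) + m (v, 1)" if "v \<in> V0" for v
  proof (cases "v = 0")
    case True
    have 0: "0 \<notin> A_cross" using A_cross_ne_zero by blast
    have "(\<Sum>v\<in>V0. l (v, 0) + l (v, 1)) = (\<Sum>v\<in>V0. m (v, 0) + m (v, 1))"
      using sum0 sum1 by (simp add: sum.distrib)
    moreover have "(\<Sum>v\<in>A_cross. l (v, 0) + l (v, 1)) = (\<Sum>v\<in>A_cross. m (v, 0) + m (v, 1))"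
      using nA by (rule sum.cong[OF refl])
    ultimately show ?thesis
      using 0 finite_A_cross True by (simp add: V0_def)
  qed (use that nA in \<open>auto simp: V0_def\<close>)
  \<comment> \<open>Less weight on top means more weight at the bottom. So \<open>S\<close> contains
    \<open>(u, 0)\<close> and \<open>(v, 1)\<close>, while \<open>S'\<close> contains
    \<open>(v, 0)\<close> and \<open>(u, 1)\<close>.\<close>
  have no_exchange: False if uv: "u \<in> V0" "v \<in> V0" "l (u, 1) < m (u, 1)" "m (v, 1) < l (v, 1)" for u v
  proof -
    have "u \<noteq> v" using uv by auto
    have "m (u, 0) < l (u, 0)" "l (v, 0) < m (v, 0)"
      using n[OF uv(1)] n[OF uv(2)] uv(3,4) by linarith+
    then have "0 < l (u, 0)" "0 < m (v, 0)" "0 < l (v, 1)" "0 < m (u, 1)"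
      using uv(3,4) S(2)[of "(u, 1)"] S(2)[of "(v, 0)"] S'(2)[of "(u, 0)"] S'(2)[of "(v, 1)"] by linarith+
    then have "(u, 0) \<in> S" "(v, 1) \<in> S" "(v, 0) \<in> S'" "(u, 1) \<in> S'"
      using S(3) S'(3) by force+
    then have "(u, v) \<in> order0" "(v, u) \<in> order0"
      using faces26D(5)[OF S(1)] faces26D(5)[OF S'(1)] uv(1,2) \<open>u \<noteq> v\<close> by simp_all
    then show False using order0_asym by blast
  qed
  have "l (v, 1) = m (v, 1)" if v: "v \<in> V0" for v
  proof (rule ccontr)
    assume ne: "l (v, 1) \<noteq> m (v, 1)"
    \<comment> \<open>Without exchanges all differences on the top level have one sign, and equal
      totals there then exclude any strict one.\<close>
    consider "\<forall>u\<in>V0. l (u, 1) \<le> m (u, 1)" | "\<forall>u\<in>V0. m (u, 1) \<le> l (u, 1)"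
      using no_exchange by (meson linorder_not_le)
    then show False
    proof cases
      case 1
      then have "(\<Sum>v\<in>V0. l (v, 1)) < (\<Sum>v\<in>V0. m (v, 1))"
        using v ne by (intro sum_strict_mono_ex1 finite_V0) force+
      then show False using sum1 by simp
    next
      case 2
      then have "(\<Sum>v\<in>V0. m (v, 1)) < (\<Sum>v\<in>V0. l (v, 1))"
        using v ne by (intro sum_strict_mono_ex1 finite_V0) force+
      then show False using sum1 by simp
    qed
  qed
  with n C8 s show ?thesis unfolding A26_eq by fastforce
qed

interpretation A26: geometric_complex A26 faces26
proof
  show "finite A26" by (rule finite_A26)
  show "S \<subseteq> A26" if "S \<in> faces26" for S using that by (simp add: faces26_def)
  show "T \<in> faces26" if "S \<in> faces26" "T \<subseteq> S" for S T using faces26_down_closed that .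
next
  fix S S' l m v
  assume S: "S \<in> faces26" "S' \<in> faces26" "\<And>v. 0 \<le> l v" "\<And>v. 0 \<le> m v" "\<And>v. v \<notin> S \<Longrightarrow> l v = 0"
      "\<And>v. v \<notin> S' \<Longrightarrow> m v = 0" and eq: "sum l A26 = sum m A26"
      "(\<Sum>v\<in>A26. l v *\<^sub>R v) = (\<Sum>v\<in>A26. m v *\<^sub>R v)" and v: "v \<in> A26"
  \<comment> \<open>Weight \<open>r\<close> on a center equals weight \<open>r / 2\<close> on its
    doubled vector \<open>(2c, 2)\<close>.\<close>
  define k :: "(real ^ 4) \<times> real \<Rightarrow> real" where "k v = (if v \<in> C8 then 1/2 else 1)" for v
  have k: "config_sum (\<lambda>v. l v * k v) = (\<Sum>v\<in>A26. l v *\<^sub>R v, sum l A26)" for l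
  proof -
    have "(l v * k v) *\<^sub>R config_vec v = (l v *\<^sub>R v, l v)" for v
      by (auto simp: k_def config_vec_def)
    then have "config_sum (\<lambda>v. l v * k v) = (\<Sum>v\<in>A26. (l v *\<^sub>R v, l v))"
      by (simp only: config_sum_def)
    then show ?thesis by (simp add: prod_eq_iff fst_sum snd_sum)
  qed
  have "l v * k v = m v * k v"
    by (rule config_sum_unique[of S "\<lambda>v. l v * k v" S' "\<lambda>v. m v * k v"])
      (use S eq v in \<open>auto simp: k\<close>, simp_all add: k_def)
  then show "l v = m v" by (simp add: k_def split: if_splits)
qed

section \<open>Covering the convex hull\<close>

lemma C8_positive:
  assumes "c \<in> C8"
  obtains v1 v2 v3 where "cyclic_triangle v1 v2 v3" "{v \<in> A_cross. 0 < fst c \<bullet> v} = {v1, v2, v3}"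
    "v1 \<noteq> v2" "v2 \<noteq> v3" "v1 \<noteq> v3" "c = ((1/2) *\<^sub>R (v1 + v2 + v3), 1/2)"
    "v1 \<in> A_cross" "v2 \<in> A_cross" "v3 \<in> A_cross"
proof -
  obtain v1 v2 v3 where v: "cyclic_triangle v1 v2 v3" "c = ((1/2) *\<^sub>R (v1 + v2 + v3), 1/2)"
    using C8_center[OF assms] .
  note vA = cyclic_triangleD[OF v(1)]
  have "v \<in> {v1, v2, v3}" if "v \<in> A_cross" "0 < fst c \<bullet> v" for v
    using that vA by (auto simp: v(2) inner_add_left inner_A_cross split: if_splits)
  moreover have "0 < fst c \<bullet> v1" "0 < fst c \<bullet> v2" "0 < fst c \<bullet> v3"
    using vA by (simp_all add: v(2) inner_add_left inner_A_cross)
  ultimately have "{v \<in> A_cross. 0 < fst c \<bullet> v} = {v1, v2, v3}"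
    using vA by blast
  with v vA that show thesis by blast
qed

section \<open>The maximal cells\<close>

abbreviation center :: "real ^ 4 \<Rightarrow> real ^ 4 \<Rightarrow> real ^ 4 \<Rightarrow> (real ^ 4) \<times> real"
  where "center u1 u2 u3 \<equiv> ((1/2) *\<^sub>R (u1 + u2 + u3), 1/2)"

text \<open>A \<open>stair\<close> cell joins the center to one of the four simplices of the prism
  over \<open>0, v1, v2, v3\<close>, in this order. Only the triangle \<open>{u1, u2, w}\<close> is
  listed, as rotating the frame gives the other two triangles containing \<open>w\<close>.\<close>

inductive max_cell :: "((real ^ 4) \<times> real) set \<Rightarrow> bool" where
  bottom: "frame u1 u2 u3 w \<Longrightarrow>
    max_cell {(0, 0), (u1, 0), (u2, 0), (u3, 0), (w, 0), center u1 u2 u3}"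
| top: "frame u1 u2 u3 w \<Longrightarrow>
    max_cell {(0, 1), (u1, 1), (u2, 1), (u3, 1), (w, 1), center u1 u2 u3}"
| stair: "\<lbrakk>frame u1 u2 u3 w; {v1, v2, v3} = {u1, u2, w};
      (v1, v2) \<in> orientation; (v1, v3) \<in> orientation; (v2, v3) \<in> orientation;
      M \<in> {{(0, 0), (v1, 0), (v2, 0), (v3, 0), (v3, 1), center u1 u2 u3},
        {(0, 0), (v1, 0), (v2, 0), (v2, 1), (v3, 1), center u1 u2 u3},
        {(0, 0), (v1, 0), (v1, 1), (v2, 1), (v3, 1), center u1 u2 u3},
        {(0, 0), (0, 1), (v1, 1), (v2, 1), (v3, 1), center u1 u2 u3}}\<rbrakk>
    \<Longrightarrow> max_cell M"

lemma frame_center_mem_C8: "frame u1 u2 u3 w \<Longrightarrow> center u1 u2 u3 \<in> C8"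
  using center_mem_C8 by (simp add: frame_def)

text \<open>Inside one frame orthonormality settles the antipode and sign conditions. If
  \<open>u3\<close> is not lifted, the remaining vertices contain no directed 3-cycle; otherwise the
  cell occupies a single level.\<close>

lemma frame_cell_mem_faces26:
  assumes fr: "frame u1 u2 u3 w"
    and M: "M \<subseteq> insert (center u1 u2 u3) ({0, u1, u2, u3, w} \<times> {0, 1})"
    and order: "\<And>u v. (u, 0) \<in> M \<Longrightarrow> (v, 1) \<in> M \<Longrightarrow> u \<noteq> v \<Longrightarrow> (u, v) \<in> order0"
    and level: "\<not> lifted M u3 \<or> (\<forall>v. (v, 0) \<notin> M) \<or> (\<forall>v. (v, 1) \<notin> M)"
  shows "M \<in> faces26"
proof (rule faces26I)
  note c = frame_center_mem_C8[OF fr]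
  note A = frame_in_A_cross[OF fr]
  have lift: "v \<in> {u1, u2, u3, w}" if "v \<in> A_cross" "lifted M v" for v
    using that M A_cross_ne_zero[of v] by (auto simp: lifted_def)
  show "M \<subseteq> A26" using M A c by (auto simp: A26_def)
  have C8: "x = center u1 u2 u3" if "x \<in> M" "x \<in> C8" for x
  proof -
    have "x \<notin> {0, u1, u2, u3, w} \<times> {0, 1}" using that(2) not_C8 by auto
    then show ?thesis using M that(1) by blast
  qed
  show "x = x'" if "x \<in> M" "x \<in> C8" "x' \<in> M" "x' \<in> C8" for x x'
    using C8[OF that(1,2)] C8[OF that(3,4)] by simp
  show "\<not> lifted M (- v)" if "v \<in> A_cross" "lifted M v" for v
  proof
    assume "lifted M (- v)"
    then have "v \<in> {u1, u2, u3, w}" "- v \<in> {u1, u2, u3, w}"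
      using lift that uminus_mem_A_cross by blast+
    moreover have "a \<bullet> b \<ge> 0" if "a \<in> {u1, u2, u3, w}" "b \<in> {u1, u2, u3, w}" for a b
      using that by (elim insertE emptyE; simp add: frame_inner[OF fr])
    ultimately have "0 \<le> v \<bullet> (- v)" by blast
    then show False using A_cross_ne_zero[OF \<open>v \<in> A_cross\<close>] inner_gt_zero_iff[of v]
      unfolding inner_minus_right by linarith
  qed
  show "0 \<le> fst x \<bullet> v" if "x \<in> M" "x \<in> C8" "v \<in> A_cross" "lifted M v" for x v
    using lift[OF that(3,4)] unfolding C8[OF that(1,2)]
    by (elim insertE emptyE) (simp_all add: inner_add_left frame_inner[OF fr])
  show "(u, v) \<in> order0" if "(u, 0) \<in> M" "(v, 1) \<in> M" "u \<noteq> v" for u v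
    using order that .
  show "(\<forall>v\<in>V0. (v, 0) \<notin> M) \<or> (\<forall>v\<in>V0. (v, 1) \<notin> M)"
    if "x \<in> C8" "\<And>v. v \<in> A_cross \<Longrightarrow> 0 < fst x \<bullet> v \<Longrightarrow> lifted M v" for x
  proof (cases "lifted M u3")
    case True
    with level show ?thesis by blast
  next
    case False
    then have "v \<in> {u1, u2, w}" if "v \<in> A_cross" "0 < fst x \<bullet> v" for v
      using lift[of v] \<open>\<And>v. v \<in> A_cross \<Longrightarrow> 0 < fst x \<bullet> v \<Longrightarrow> lifted M v\<close> that by blast
    then show ?thesis using no_cyclic_in_frame_face[OF fr \<open>x \<in> C8\<close>] by blast
  qed
qed

lemma max_cell_mem_faces26: "max_cell M \<Longrightarrow> M \<in> faces26"
proof (induction rule: max_cell.induct)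
  case (bottom u1 u2 u3 w)
  then show ?case by (intro frame_cell_mem_faces26[OF bottom]) auto
next
  case (top u1 u2 u3 w)
  then show ?case by (intro frame_cell_mem_faces26[OF top]) auto
next
  case (stair u1 u2 u3 w v1 v2 v3 M)
  note A = frame_in_A_cross[OF stair(1)] and ne = frame_distinct[OF stair(1)]
  have v: "v1 \<in> {u1, u2, w}" "v2 \<in> {u1, u2, w}" "v3 \<in> {u1, u2, w}" using stair(2) by blast+
  then have "v1 \<in> A_cross" "v2 \<in> A_cross" "v3 \<in> A_cross" using A by blast+
  then have o: "(v1, v2) \<in> order0" "(v1, v3) \<in> order0" "(v2, v3) \<in> order0"
    "(0, v1) \<in> order0" "(0, v2) \<in> order0" "(0, v3) \<in> order0"
    using stair by (auto simp: order0_def)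
  have "v1 \<noteq> u3" "v2 \<noteq> u3" "v3 \<noteq> u3" "u3 \<noteq> 0" using v ne A A_cross_ne_zero by auto
  then have l: "\<not> lifted M u3" using stair(6) by (auto simp: lifted_def)
  have sub: "M \<subseteq> insert (center u1 u2 u3) ({0, u1, u2, u3, w} \<times> {0, 1})"
    using stair(6) v by auto
  show ?case
  proof (rule frame_cell_mem_faces26[OF stair(1) sub])
    show "(x, y) \<in> order0" if "(x, 0) \<in> M" "(y, 1) \<in> M" "x \<noteq> y" for x y
      using stair(6) that o by (elim insertE emptyE; hypsubst; simp; blast?)
  qed (use l in blast)
qed

text \<open>The weights are indexed by list positions, so coinciding points are allowed.\<close>

lemma convex_hull_6:
  fixes x1 :: "'a::real_vector"
  assumes k: "0 \<le> k1" "0 \<le> k2" "0 \<le> k3" "0 \<le> k4" "0 \<le> k5" "0 \<le> k6"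
    and sum: "k1 + k2 + k3 + k4 + k5 + k6 = 1"
    and x: "x = k1 *\<^sub>R x1 + k2 *\<^sub>R x2 + k3 *\<^sub>R x3 + k4 *\<^sub>R x4 + k5 *\<^sub>R x5 + k6 *\<^sub>R x6"
  shows "x \<in> convex hull {x1, x2, x3, x4, x5, x6}"
proof -
  let ?ks = "[k1, k2, k3, k4, k5, k6]" and ?xs = "[x1, x2, x3, x4, x5, x6]"
  have "(\<Sum>i<length ?ks. ?ks ! i *\<^sub>R ?xs ! i) \<in> convex hull (set ?xs)"
  proof (rule convex_sum)
    show "(\<Sum>i<length ?ks. ?ks ! i) = 1"
      using sum by (simp add: eval_nat_numeral)
    have "\<forall>k\<in>set ?ks. 0 \<le> k" using k by simp
    then show "0 \<le> ?ks ! i" if "i \<in> {..<length ?ks}" for i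
      using that nth_mem[of i ?ks] by blast
    show "?xs ! i \<in> convex hull (set ?xs)" if "i \<in> {..<length ?ks}" for i
      using that nth_mem[of i ?xs] by (intro hull_inc) (simp only: length_Cons list.size lessThan_iff)
  qed (simp_all only: finite_lessThan convex_convex_hull)
  moreover have "(\<Sum>i<length ?ks. ?ks ! i *\<^sub>R ?xs ! i) = x"
    using x by (simp add: eval_nat_numeral)
  ultimately show ?thesis by (simp only: list.set)
qed

section \<open>Valid inequalities for the convex hull\<close>

lemma frame_inner_A_cross_le:
  assumes fr: "frame u1 u2 u3 w" and v: "v \<in> A_cross"
  shows "(u1 + u2 + u3 + w) \<bullet> v \<le> 1" "(u1 + u2 + w) \<bullet> v \<le> 1"
  using v unfolding A_cross_frame[OF fr]
  by (elim insertE emptyE; hypsubst; simp add: inner_add_left frame_inner[OF fr])+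

text \<open>A center is half a sum of three vertices, each contributing at most 1. Its coordinates
  lie in {-1/2, 0, 1/2}, so exceeding 1 on \<open>u1 + u2 + w\<close> would make
  \<open>{u1, u2, w}\<close> a directed 3-cycle.\<close>

lemma frame_inner_C8_le:
  assumes fr: "frame u1 u2 u3 w" and c: "c \<in> C8"
  shows "(u1 + u2 + u3 + w) \<bullet> fst c \<le> 3/2" "(u1 + u2 + w) \<bullet> fst c \<le> 1"
proof -
  obtain v1 v2 v3 where v: "{v \<in> A_cross. 0 < fst c \<bullet> v} = {v1, v2, v3}"
      "v1 \<noteq> v2" "v2 \<noteq> v3" "v1 \<noteq> v3" "c = center v1 v2 v3" "v1 \<in> A_cross" "v2 \<in> A_cross" "v3 \<in> A_cross"
    by (rule C8_positive[OF c])
  have "(u1 + u2 + u3 + w) \<bullet> fst c = ((u1 + u2 + u3 + w) \<bullet> v1 + (u1 + u2 + u3 + w) \<bullet> v2 +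
      (u1 + u2 + u3 + w) \<bullet> v3) / 2"
    by (simp add: v(5) inner_add_right)
  also have "\<dots> \<le> 3/2"
  proof -
    have "(a + b + d) / 2 \<le> 3/2" if "a \<le> 1" "b \<le> 1" "d \<le> 1" for a b d :: real
      using that by simp
    then show ?thesis using v(6-8)[THEN frame_inner_A_cross_le(1)[OF fr]] .
  qed
  finally show "(u1 + u2 + u3 + w) \<bullet> fst c \<le> 3/2" .
  show "(u1 + u2 + w) \<bullet> fst c \<le> 1"
  proof (rule ccontr)
    assume "\<not> ?thesis"
    then have "1 < fst c \<bullet> u1 + fst c \<bullet> u2 + fst c \<bullet> w"
      by (simp add: inner_commute[of _ "fst c"] inner_add_right)
    then have "0 < fst c \<bullet> u1" "0 < fst c \<bullet> u2" "0 < fst c \<bullet> w"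
      using fst_C8_inner[OF c frame_in_A_cross(1)[OF fr]] fst_C8_inner[OF c frame_in_A_cross(2)[OF fr]]
        fst_C8_inner[OF c frame_in_A_cross(4)[OF fr]] by auto
    then have "{u1, u2, w} \<subseteq> {v1, v2, v3}"
      using v(1) frame_in_A_cross[OF fr] by blast
    moreover have "card {u1, u2, w} = 3" "card {v1, v2, v3} = 3"
      using frame_distinct[OF fr] v(2-4) by auto
    ultimately have "{u1, u2, w} = {v1, v2, v3}"
      by (metis card_subset_eq finite.emptyI finite_insert)
    then show False
      using no_cyclic_in_frame_face[OF fr c] v(1) by blast
  qed
qed

lemma conv_A26_le:
  assumes x: "(p, t) \<in> convex hull A26"
    and V0: "\<And>v. v \<in> V0 \<Longrightarrow> a \<bullet> v \<le> b" "\<And>v. v \<in> V0 \<Longrightarrow> a \<bullet> v + r \<le> b"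
    and C8: "\<And>c. c \<in> C8 \<Longrightarrow> a \<bullet> fst c + r / 2 \<le> b"
  shows "a \<bullet> p + r * t \<le> b"
proof -
  have "A26 \<subseteq> {x. (a, r) \<bullet> x \<le> b}"
  proof
    fix x assume "x \<in> A26"
    then consider v where "v \<in> V0" "x = (v, 0)" | v where "v \<in> V0" "x = (v, 1)" | "x \<in> C8"
      unfolding A26_eq by blast
    then show "x \<in> {x. (a, r) \<bullet> x \<le> b}"
    proof cases
      case 3
      show ?thesis using C8[OF 3] by (simp add: inner_prod_def snd_C8[OF 3])
    qed (use V0 in \<open>simp_all add: inner_prod_def\<close>)
  qed
  then have "convex hull A26 \<subseteq> {x. (a, r) \<bullet> x \<le> b}"
    by (rule hull_minimal) (rule convex_halfspace_le)
  then show ?thesis using x by auto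
qed

text \<open>The three frame inequalities are what keeps the weight of \<open>(0, 0)\<close> or
  \<open>(0, 1)\<close> nonnegative in the stair, bottom and top cells of the covering
  argument.\<close>

lemma conv_A26_bounds:
  assumes x: "(p, t) \<in> convex hull A26"
  shows "0 \<le> t" "t \<le> 1"
    and "frame u1 u2 u3 w \<Longrightarrow> (u1 + u2 + w) \<bullet> p \<le> 1"
    and "frame u1 u2 u3 w \<Longrightarrow> (u1 + u2 + u3 + w) \<bullet> p - t \<le> 1"
    and "frame u1 u2 u3 w \<Longrightarrow> (u1 + u2 + u3 + w) \<bullet> p + t \<le> 2"
proof -
  show "0 \<le> t" using conv_A26_le[OF x, of 0 0 "-1"] by simp
  show "t \<le> 1" using conv_A26_le[OF x, of 0 1 1] by simp
  assume fr: "frame u1 u2 u3 w"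
  have 1: "(u1 + u2 + w) \<bullet> v \<le> 1" "(u1 + u2 + u3 + w) \<bullet> v \<le> 1" if "v \<in> V0" for v
    using that frame_inner_A_cross_le[OF fr, of v] by (auto simp: V0_def)
  note 2 = frame_inner_C8_le[OF fr]
  show "(u1 + u2 + w) \<bullet> p \<le> 1"
    using conv_A26_le[OF x, of "u1 + u2 + w" 1 0] 1 2 by simp
  \<comment> \<open>At centers the bound 3/2 combines with the height 1/2 to 3/2 - 1/2 = 1 here and
    to 3/2 + 1/2 = 2 below.\<close>
  show "(u1 + u2 + u3 + w) \<bullet> p - t \<le> 1"
    using conv_A26_le[OF x, of "u1 + u2 + u3 + w" 1 "-1"] 1 2 by fastforce
  show "(u1 + u2 + u3 + w) \<bullet> p + t \<le> 2"
    using conv_A26_le[OF x, of "u1 + u2 + u3 + w" 2 1] 1 2 by fastforce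
qed

text \<open>The weights are those of the prism triangulation: the excess height \<open>t - g\<close> is spent on \<open>v\<^sub>3\<close>,
  \<open>v\<^sub>2\<close>, \<open>v\<^sub>1\<close> and \<open>0\<close>, in this order.\<close>

lemma stair_cover:
  assumes fr: "frame u1 u2 u3 w" "{v1, v2, v3} = {u1, u2, w}"
      "(v1, v2) \<in> orientation" "(v1, v3) \<in> orientation" "(v2, v3) \<in> orientation"
    and p: "p = m1 *\<^sub>R v1 + m2 *\<^sub>R v2 + m3 *\<^sub>R v3 + g *\<^sub>R (u1 + u2 + u3)"
    and m: "0 \<le> m1" "0 \<le> m2" "0 \<le> m3" "0 \<le> g" "m1 + m2 + m3 + 2 * g \<le> 1" "g \<le> t" "t \<le> 1 - g"
  shows "\<exists>M. max_cell M \<and> (p, t) \<in> convex hull M"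
proof -
  note cells = stair[OF fr]
  \<comment> \<open>The center has height 1/2 and weight \<open>2 * g\<close>, so it accounts for
    height \<open>g\<close>. The partial sums of the \<open>m\<close>s decide which vertex is used
    on both levels.\<close>
  consider "t - g \<le> m3" | "m3 \<le> t - g" "t - g \<le> m2 + m3"
    | "m2 + m3 \<le> t - g" "t - g \<le> m1 + m2 + m3" | "m1 + m2 + m3 \<le> t - g"
    by linarith
  then show ?thesis
  proof cases
    case 1
    let ?M = "{(0, 0), (v1, 0), (v2, 0), (v3, 0), (v3, 1), center u1 u2 u3}"
    have "max_cell ?M" by (rule cells) simp
    moreover have "(p, t) \<in> convex hull ?M"
      by (rule convex_hull_6[where ?k1.0 = "1 - 2 * g - m1 - m2 - m3" and ?k2.0 = m1 and ?k3.0 = m2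
          and ?k4.0 = "m3 - (t - g)" and ?k5.0 = "t - g" and ?k6.0 = "2 * g"])
        (use m 1 in \<open>simp_all add: p scaleR_diff_left\<close>)
    ultimately show ?thesis by blast
  next
    case 2
    let ?M = "{(0, 0), (v1, 0), (v2, 0), (v2, 1), (v3, 1), center u1 u2 u3}"
    have "max_cell ?M" by (rule cells) simp
    moreover have "(p, t) \<in> convex hull ?M"
      by (rule convex_hull_6[where ?k1.0 = "1 - 2 * g - m1 - m2 - m3" and ?k2.0 = m1
          and ?k3.0 = "m2 + m3 - (t - g)" and ?k4.0 = "t - g - m3" and ?k5.0 = m3 and ?k6.0 = "2 * g"])
        (use m 2 in \<open>simp_all add: p algebra_simps\<close>)
    ultimately show ?thesis by blast
  next
    case 3
    let ?M = "{(0, 0), (v1, 0), (v1, 1), (v2, 1), (v3, 1), center u1 u2 u3}"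
    have "max_cell ?M" by (rule cells) simp
    moreover have "(p, t) \<in> convex hull ?M"
      by (rule convex_hull_6[where ?k1.0 = "1 - 2 * g - m1 - m2 - m3" and ?k2.0 = "m1 + m2 + m3 - (t - g)"
          and ?k3.0 = "t - g - m2 - m3" and ?k4.0 = m2 and ?k5.0 = m3 and ?k6.0 = "2 * g"])
        (use m 3 in \<open>simp_all add: p algebra_simps\<close>)
    ultimately show ?thesis by blast
  next
    case 4
    let ?M = "{(0, 0), (0, 1), (v1, 1), (v2, 1), (v3, 1), center u1 u2 u3}"
    have "max_cell ?M" by (rule cells) simp
    moreover have "(p, t) \<in> convex hull ?M"
      by (rule convex_hull_6[where ?k1.0 = "1 - 2 * g - (t - g)" and ?k2.0 = "t - g - m1 - m2 - m3"
          and ?k3.0 = m1 and ?k4.0 = m2 and ?k5.0 = m3 and ?k6.0 = "2 * g"])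
        (use m 4 in \<open>simp_all add: p algebra_simps\<close>)
    ultimately show ?thesis by blast
  qed
qed

lemma max_cell_cover:
  assumes x: "(p, t) \<in> convex hull A26"
  shows "\<exists>M. max_cell M \<and> (p, t) \<in> convex hull M"
proof -
  obtain u1 u2 u3 w x1 x2 x3 y where fr: "frame u1 u2 u3 w"
    and p: "p = x1 *\<^sub>R u1 + x2 *\<^sub>R u2 + x3 *\<^sub>R u3 + y *\<^sub>R w"
    and pos: "0 \<le> x3" "x3 \<le> x1" "x3 \<le> x2" "0 \<le> y"
    by (rule ex_frame_min)
  note inner = frame_inner[OF fr]
  have "(u1 + u2 + w) \<bullet> p = x1 + x2 + y" "(u1 + u2 + u3 + w) \<bullet> p = x1 + x2 + x3 + y"
    by (simp_all add: p inner_add_left inner_add_right inner)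
  then have b: "0 \<le> t" "t \<le> 1" "x1 + x2 + y \<le> 1" "x1 + x2 + x3 + y - t \<le> 1" "x1 + x2 + x3 + y + t \<le> 2"
    using conv_A26_bounds[OF x] fr by metis+
  \<comment> \<open>The cases tell which of \<open>x3\<close>, \<open>t\<close> and
    \<open>1 - t\<close> is the minimum \<open>g\<close>.\<close>
  consider "x3 \<le> t" "x3 \<le> 1 - t" | "t \<le> x3" "t \<le> 1 - t" | "1 - t \<le> x3" "1 - t \<le> t"
    by linarith
  then show ?thesis
  proof cases
    case 1
    have u: "(u1, u2) \<in> orientation" using fr by (simp add: frame_def cyclic_triangle_def)
    \<comment> \<open>As \<open>w\<close> is a source or a sink, it comes before
      \<open>u1, u2\<close> or after them. The residual weights on \<open>u1\<close>,
      \<open>u2\<close>, \<open>w\<close> are \<open>x1 - x3\<close>, \<open>x2 - x3\<close>,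
      \<open>y\<close>.\<close>
    have "(w, u1) \<in> orientation \<and> (w, u2) \<in> orientation \<or> (u1, w) \<in> orientation \<and> (u2, w) \<in> orientation"
      using frame_source_or_sink[OF fr] by blast
    then show ?thesis
    proof (elim disjE conjE)
      assume "(w, u1) \<in> orientation" "(w, u2) \<in> orientation"
      then show ?thesis
        by (intro stair_cover[OF fr, of w u1 u2 p y "x1 - x3" "x2 - x3" x3 t])
          (use u b pos 1 in \<open>auto simp: p algebra_simps\<close>)
    next
      assume "(u1, w) \<in> orientation" "(u2, w) \<in> orientation"
      then show ?thesis
        by (intro stair_cover[OF fr, of u1 u2 w p "x1 - x3" "x2 - x3" y x3 t])
          (use u b pos 1 in \<open>auto simp: p algebra_simps\<close>)
    qed
  next
    case 2
    \<comment> \<open>With \<open>g = t\<close> the center supplies all the height, so the other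
      vertices stay at the bottom; the next case is its mirror image under exchanging
      \<open>t\<close> and \<open>1 - t\<close>.\<close>
    have "(p, t) \<in> convex hull {(0, 0), (u1, 0), (u2, 0), (u3, 0), (w, 0), center u1 u2 u3}"
      by (rule convex_hull_6[where ?k1.0 = "1 + t - x1 - x2 - x3 - y" and ?k2.0 = "x1 - t"
          and ?k3.0 = "x2 - t" and ?k4.0 = "x3 - t" and ?k5.0 = y and ?k6.0 = "2 * t"])
        (use b pos 2 in \<open>simp_all add: p algebra_simps\<close>)
    then show ?thesis using bottom[OF fr] by blast
  next
    case 3
    have "(p, t) \<in> convex hull {(0, 1), (u1, 1), (u2, 1), (u3, 1), (w, 1), center u1 u2 u3}"
      by (rule convex_hull_6[where ?k1.0 = "1 + (1 - t) - x1 - x2 - x3 - y" and ?k2.0 = "x1 - (1 - t)"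
          and ?k3.0 = "x2 - (1 - t)" and ?k4.0 = "x3 - (1 - t)" and ?k5.0 = y and ?k6.0 = "2 * (1 - t)"])
        (use b pos 3 in \<open>simp_all add: p algebra_simps\<close>)
    then show ?thesis using top[OF fr] by blast
  qed
qed

text \<open>No classification of the faces is required: some maximal cell covers the barycenter of
  \<open>S\<close>, and uniqueness of weights puts all of \<open>S\<close> into it.\<close>

lemma ex_max_cell_superset:
  assumes S: "S \<in> faces26"
  shows "\<exists>M. max_cell M \<and> S \<subseteq> M"
proof (cases "S = {}")
  case True
  have "(0, 0) \<in> convex hull A26" by (rule hull_inc) (simp add: A26_def)
  then show ?thesis using max_cell_cover True by blast
next
  case False
  let ?x = "\<Sum>v\<in>S. (1 / card S) *\<^sub>R v"
  have "0 < card S" using False A26.finite_simplex[OF S] card_gt_0_iff by blast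
  then have "?x \<in> convex hull S"
    by (intro convex_sum A26.finite_simplex[OF S] convex_convex_hull) (auto simp: hull_inc)
  then have "?x \<in> convex hull A26"
    using hull_mono[OF A26.simplex_subset[OF S]] by blast
  then obtain M where "max_cell M" "?x \<in> convex hull M"
    using max_cell_cover by (metis surj_pair)
  then show ?thesis
    using A26.simplex_subset_if_barycenter[OF S False max_cell_mem_faces26] by blast
qed

section \<open>Unimodularity and the prisms\<close>

interpretation Z: module int_scale
  by (rule module_int_scale)

lemma config_vec_inj: "inj_on config_vec A26"
proof (rule inj_onI)
  fix x y assume "config_vec x = config_vec y"
  then show "x = y" by (auto simp: config_vec_def split: if_splits)
qed

text \<open>A \<open>Z.subspace\<close> is an additive subgroup; the hypotheses put into it a
  lattice basis adapted to the frame.\<close>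

lemma config_vec_subspace:
  assumes H: "Z.subspace H" and fr: "frame u1 u2 u3 w"
    and unit: "((0, 0), 1) \<in> H" "((0, 1), 0) \<in> H"
    and u: "((u1, 0), 0) \<in> H" "((u2, 0), 0) \<in> H" "((u3, 0), 0) \<in> H" "((w, 0), 0) \<in> H"
  shows "config_vec ` A26 \<subseteq> H"
proof -
  have add: "x + y \<in> H" if "x \<in> H" "y \<in> H" for x y
    using Z.subspace_add[OF H] that .
  have uminus: "((- v, 0), 0) \<in> H" if "((v, 0), 0) \<in> H" for v
    using Z.subspace_neg[OF H that] by simp
  have V0: "((v, 0), 0) \<in> H" if "v \<in> V0" for v
    using that u uminus Z.subspace_0[OF H] unfolding V0_def A_cross_frame[OF fr]
    by (auto simp: zero_prod_def)
  have A0: "((v, 0), 1) \<in> H" if "v \<in> V0" for v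
    using add[OF V0[OF that] unit(1)] by simp
  have A1: "((v, 1), 1) \<in> H" if "v \<in> V0" for v
    using add[OF A0[OF that] unit(2)] by simp
  have "config_vec c \<in> H" if c: "c \<in> C8" for c
  proof -
    obtain v1 v2 v3 where v: "c = center v1 v2 v3" "v1 \<in> A_cross" "v2 \<in> A_cross" "v3 \<in> A_cross"
      by (rule C8_positive[OF c])
    then have "v1 \<in> V0" "v2 \<in> V0" "v3 \<in> V0" by (simp_all add: V0_def)
    \<comment> \<open>The vector \<open>((v1 + v2 + v3, 1), 2)\<close> is the sum of
      \<open>((v1, 0), 0)\<close>, \<open>((v2, 0), 1)\<close> and
      \<open>((v3, 1), 1)\<close>.\<close>
    from add[OF add[OF V0[OF this(1)] A0[OF this(2)]] A1[OF this(3)]]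
    show ?thesis using config_vec_simps(3)[OF c] by (simp add: v(1))
  qed
  with A0 A1 show ?thesis
    unfolding A26_eq by (auto simp: config_vec_simps)
qed

lemma config_vec_center:
  "frame u1 u2 u3 w \<Longrightarrow> config_vec (center u1 u2 u3) = ((u1 + u2 + u3, 1), 2)"
  using config_vec_simps(3)[OF frame_center_mem_C8] by simp

lemma max_cell_span:
  assumes "max_cell M" and H: "Z.subspace H" and M: "config_vec ` M \<subseteq> H"
  shows "config_vec ` A26 \<subseteq> H"
proof -
  have diff: "x - y \<in> H" if "x \<in> H" "y \<in> H" for x y
    using Z.subspace_diff[OF H] that .
  have config: "config_vec x \<in> H" if "x \<in> M" for x
    using M that by blast
  have *: "((x, 0), 0) \<in> H" if "((x, r), 1) \<in> H" "((0, r), 1) \<in> H" for x r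
    using diff[OF that] by simp
  from assms(1) show ?thesis
  proof cases
    case (bottom u1 u2 u3 w)
    note fr = \<open>frame u1 u2 u3 w\<close>
    have 0: "((0, 0), 1) \<in> H" and v: "((u1, 0), 1) \<in> H" "((u2, 0), 1) \<in> H" "((u3, 0), 1) \<in> H" "((w, 0), 1) \<in> H"
      and c: "((u1 + u2 + u3, 1), 2) \<in> H"
      using config[of "(0, 0)"] config[of "(u1, 0)"] config[of "(u2, 0)"] config[of "(u3, 0)"]
        config[of "(w, 0)"] config[of "center u1 u2 u3"]
      by (simp_all add: bottom(1) config_vec_simps config_vec_center[OF fr])
    note u = v[THEN *[OF _ 0]]
    \<comment> \<open>The vertical unit vector is not a difference of bottom vertices; it comes from
      the center by subtracting \<open>((u1, 0), 0)\<close>, \<open>((u2, 0), 1)\<close> and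
      \<open>((u3, 0), 1)\<close>.\<close>
    have "((0, 1), 0) \<in> H"
      using diff[OF diff[OF diff[OF c u(1)] v(2)] v(3)] by simp
    with config_vec_subspace[OF H fr 0 _ u] show ?thesis by blast
  next
    case (top u1 u2 u3 w)
    note fr = \<open>frame u1 u2 u3 w\<close>
    have 1: "((0, 1), 1) \<in> H" and v: "((u1, 1), 1) \<in> H" "((u2, 1), 1) \<in> H" "((u3, 1), 1) \<in> H" "((w, 1), 1) \<in> H"
      and c: "((u1 + u2 + u3, 1), 2) \<in> H"
      using config[of "(0, 1)"] config[of "(u1, 1)"] config[of "(u2, 1)"] config[of "(u3, 1)"]
        config[of "(w, 1)"] config[of "center u1 u2 u3"]
      by (simp_all add: top(1) config_vec_simps config_vec_center[OF fr])
    note u = v[THEN *[OF _ 1]]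
    have "((0, 0), 1) \<in> H"
      using diff[OF diff[OF diff[OF c u(1)] u(2)] v(3)] by (simp add: zero_prod_def)
    moreover from diff[OF 1 this] have "((0, 1), 0) \<in> H" by simp
    ultimately show ?thesis using config_vec_subspace[OF H fr _ _ u] by blast
  next
    case (stair u1 u2 u3 w v1 v2 v3)
    note fr = \<open>frame u1 u2 u3 w\<close>
    have "center u1 u2 u3 \<in> M" "(0, 0) \<in> M"
      using stair(6) by (elim insertE emptyE; simp)+
    from this[THEN config] have c: "((u1 + u2 + u3, 1), 2) \<in> H" and 0: "((0, 0), 1) \<in> H"
      unfolding config_vec_center[OF fr] config_vec_simps by this+
    \<comment> \<open>Every staircase uses one vertex, possibly 0, on both levels; the difference is
      the vertical unit vector.\<close>
    have "\<exists>v. (v, 0) \<in> M \<and> (v, 1) \<in> M"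
      using stair(6) by (elim insertE emptyE; blast)
    then obtain v where "(v, 0) \<in> M" "(v, 1) \<in> M" by blast
    from diff[OF config[OF this(2)] config[OF this(1)]] have T: "((0, 1), 0) \<in> H"
      by (simp add: config_vec_simps)
    have "((v, 0), 0) \<in> H" if "v \<in> {v1, v2, v3}" for v
    proof -
      have "(v, 0) \<in> M \<or> (v, 1) \<in> M" using stair(6) that by (elim insertE emptyE; simp)
      then show ?thesis
      proof
        assume "(v, 0) \<in> M"
        from diff[OF config[OF this] 0] show ?thesis by (simp add: config_vec_simps)
      next
        assume "(v, 1) \<in> M"
        from diff[OF diff[OF config[OF this] 0] T] show ?thesis by (simp add: config_vec_simps)
      qed
    qed
    then have u: "((u1, 0), 0) \<in> H" "((u2, 0), 0) \<in> H" "((w, 0), 0) \<in> H"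
      using stair(2) by auto
    \<comment> \<open>The cell has no vertex over \<open>u3\<close>, so \<open>u3\<close> is
      recovered from the center.\<close>
    have "((u3, 0), 0) \<in> H"
      using diff[OF diff[OF diff[OF diff[OF diff[OF c T] 0] 0] u(1)] u(2)] by simp
    with config_vec_subspace[OF H fr 0 T u(1,2) _ u(3)] show ?thesis by blast
  qed
qed

text \<open>Splitting an integral relation into positive and negative parts gives two nonnegative
  representations on \<open>S\<close>, which \<open>config_sum_unique\<close> identifies.\<close>

lemma config_vec_independent:
  assumes S: "S \<in> faces26"
  shows "\<not> Z.dependent (config_vec ` S)"
proof
  assume "Z.dependent (config_vec ` S)"
  then obtain t u y where t: "finite t" "t \<subseteq> config_vec ` S" "(\<Sum>v\<in>t. int_scale (u v) v) = 0"
    and y: "y \<in> t" "u y \<noteq> 0"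
    unfolding Z.dependent_explicit by blast
  define S0 where "S0 = {s \<in> S. config_vec s \<in> t}"
  have S0: "S0 \<subseteq> A26" "S0 \<subseteq> S" "config_vec ` S0 = t"
    using A26.simplex_subset[OF S] t(2) by (auto simp: S0_def)
  have inj: "inj_on config_vec S0" using config_vec_inj S0(1) inj_on_subset by blast
  define k :: "(real ^ 4) \<times> real \<Rightarrow> real" where "k s = (if s \<in> S0 then of_int (u (config_vec s)) else 0)" for s
  have "(\<Sum>s\<in>A26. k s *\<^sub>R config_vec s) = (\<Sum>s\<in>S0. k s *\<^sub>R config_vec s)"
    using S0(1) finite_A26 by (intro sum.mono_neutral_right) (auto simp: k_def)
  also have "\<dots> = (\<Sum>s\<in>S0. int_scale (u (config_vec s)) (config_vec s))"
    by (intro sum.cong) (auto simp: k_def int_scale_def)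
  also have "\<dots> = (\<Sum>v\<in>t. int_scale (u v) v)"
    using sum.reindex[OF inj, of "\<lambda>v. int_scale (u v) v"] S0(3) by simp
  finally have k0: "(\<Sum>s\<in>A26. k s *\<^sub>R config_vec s) = 0" using t(3) by simp
  have "k s = max 0 (k s) - max 0 (- k s)" for s by linarith
  then have "(\<Sum>s\<in>A26. k s *\<^sub>R config_vec s) =
      (\<Sum>s\<in>A26. max 0 (k s) *\<^sub>R config_vec s - max 0 (- k s) *\<^sub>R config_vec s)"
    by (metis scaleR_diff_left)
  then have eq: "config_sum (\<lambda>s. max 0 (k s)) = config_sum (\<lambda>s. max 0 (- k s))"
    using k0 by (simp add: config_sum_def sum_subtractf)
  obtain s where s: "s \<in> S0" "y = config_vec s" using y(1) S0(3) by blast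
  have "max 0 (k s) = max 0 (- k s)"
    by (rule config_sum_unique[OF S _ _ S _ _ eq]) (use s S0 in \<open>auto simp: k_def\<close>)
  then have "k s = 0" by linarith
  then show False using s y(2) by (simp add: k_def)
qed

lemma max_cell_lattice_basis:
  assumes M: "max_cell M"
  shows "lattice_basis (config_vec ` M) (config_vec ` A26)"
  unfolding lattice_basis_def
proof
  note D = max_cell_mem_faces26[OF M]
  show "\<not> Z.dependent (config_vec ` M)" by (rule config_vec_independent[OF D])
  show "Z.span (config_vec ` M) = Z.span (config_vec ` A26)"
  proof
    show "Z.span (config_vec ` M) \<subseteq> Z.span (config_vec ` A26)"
      by (intro Z.span_mono image_mono A26.simplex_subset[OF D])
    show "Z.span (config_vec ` A26) \<subseteq> Z.span (config_vec ` M)"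
      by (intro Z.span_minimal max_cell_span[OF M] Z.subspace_span Z.span_superset)
  qed
qed

section \<open>The prism cells belong to the complex\<close>

lemma prism_cell_mem_faces26:
  assumes F: "F \<in> K_cross" and vs: "vertex_order orientation F vs" and i: "i < length vs"
  shows "(\<lambda>v. (v, 0)) ` set (take (Suc i) vs) \<union> (\<lambda>v. (v, 1)) ` set (drop i vs) \<in> faces26"
    (is "?X \<in> faces26")
proof (rule faces26I)
  note V = card_vertices_K_cross[OF F]
  have set_vs: "set vs = vertices F" using vs by (simp add: vertex_order_def)
  have lift: "v \<in> vertices F" if "lifted ?X v" for v
    using that set_take_subset[of "Suc i" vs] set_drop_subset[of i vs] set_vs by (auto simp: lifted_def)
  show "?X \<subseteq> A26"
    using V(1) set_take_subset[of "Suc i" vs] set_drop_subset[of i vs] set_vs by (auto simp: A26_def)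
  have no_C8: "c \<notin> C8" if "c \<in> ?X" for c using that by auto
  show "c = c'" if "c \<in> ?X" "c \<in> C8" for c c' using no_C8 that by blast
  show "0 \<le> fst c \<bullet> v" if "c \<in> ?X" "c \<in> C8" for c v using no_C8 that by blast
  show "\<not> lifted ?X (- v)" if "lifted ?X v" for v
    using V(4)[OF lift lift, of "- v" v] that by auto
  show "(u, v) \<in> order0" if uv: "(u, 0) \<in> ?X" "(v, 1) \<in> ?X" "u \<noteq> v" for u v
  proof -
    have "u \<in> set (take (Suc i) vs)" "v \<in> set (drop i vs)" using uv by auto
    then obtain j k where j: "j < Suc i" "u = vs ! j" and "k < length vs - i" and k: "v = vs ! (i + k)"
      using i by (auto simp: in_set_conv_nth)
    then have k': "i + k < length vs" by linarith
    \<comment> \<open>The lists \<open>take (Suc i) vs\<close> and \<open>drop i vs\<close> share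
      the entry at \<open>i\<close>, so \<open>j\<close> is at most \<open>i + k\<close>, and
      equality would give \<open>u = v\<close>.\<close>
    have "j < i + k" using uv(3) j k by (cases "j = i + k") auto
    then have "(u, v) \<in> orientation" using vs j k k' by (simp add: vertex_order_def)
    then show ?thesis by (simp add: order0_def)
  qed
  show "(\<forall>v\<in>V0. (v, 0) \<notin> ?X) \<or> (\<forall>v\<in>V0. (v, 1) \<notin> ?X)"
    if c: "c \<in> C8" and pos: "\<And>v. v \<in> A_cross \<Longrightarrow> 0 < fst c \<bullet> v \<Longrightarrow> lifted ?X v" for c
  proof -
    \<comment> \<open>The removed triangle of \<open>c\<close> would consist of vertices of
      \<open>F\<close>. As \<open>F\<close> has at most three, it would be that triangle, which
      \<open>K_cross\<close> excludes.\<close>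
    obtain v1 v2 v3 where v: "cyclic_triangle v1 v2 v3" "{v \<in> A_cross. 0 < fst c \<bullet> v} = {v1, v2, v3}"
      "v1 \<noteq> v2" "v2 \<noteq> v3" "v1 \<noteq> v3"
      by (rule C8_positive[OF c])
    have "{v1, v2, v3} \<subseteq> vertices F" using v(2) pos lift by blast
    moreover have "card {v1, v2, v3} = 3" using v(3-5) by simp
    ultimately have "vertices F = {v1, v2, v3}"
      using V(2,3) by (metis card_seteq)
    then have False
      using V(5) orientation_cyclic v(1) by (simp add: cyclic_triangle_def)
    then show ?thesis ..
  qed
qed

lemma T_prism_subset: "T_prism \<subseteq> (hull) convex ` faces26"
proof
  fix S assume "S \<in> T_prism"
  then obtain F vs i where F: "F \<in> K_cross" "vertex_order orientation F vs" "i < length vs"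
    and S: "S face_of convex hull ((\<lambda>v. (v, 0)) ` set (take (Suc i) vs) \<union> (\<lambda>v. (v, 1)) ` set (drop i vs))"
    unfolding T_prism_def prism_triangulation_def by blast
  have "convex hull ((\<lambda>v. (v, 0)) ` set (take (Suc i) vs) \<union> (\<lambda>v. (v, 1)) ` set (drop i vs))
      \<in> (hull) convex ` faces26"
    using prism_cell_mem_faces26[OF F] by blast
  then show "S \<in> (hull) convex ` faces26"
    using S A26.simplicial_complex_simplices unfolding simplicial_complex_def by blast
qed

lemma triangulation_faces26: "triangulation_of A26 ((hull) convex ` faces26)"
  unfolding triangulation_of_def
proof (intro conjI ballI)
  show "simplicial_complex ((hull) convex ` faces26)" by (rule A26.simplicial_complex_simplices)
  show "vertices S \<subseteq> A26" if "S \<in> (hull) convex ` faces26" for S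
    using that A26.vertices_convex_hull_simplex A26.simplex_subset by auto
  show "\<Union> ((hull) convex ` faces26) = convex hull A26"
  proof
    show "\<Union> ((hull) convex ` faces26) \<subseteq> convex hull A26"
      using hull_mono A26.simplex_subset by blast
    show "convex hull A26 \<subseteq> \<Union> ((hull) convex ` faces26)"
    proof
      fix x assume "x \<in> convex hull A26"
      then obtain M where "max_cell M" "x \<in> convex hull M"
        using max_cell_cover[of "fst x" "snd x"] by auto
      then show "x \<in> \<Union> ((hull) convex ` faces26)" using max_cell_mem_faces26 by blast
    qed
  qed
qed

text \<open>A maximal simplex coincides with the hull of a maximal cell containing it, and affine
  independence recovers the vertices of that cell.\<close>

lemma unimodular_faces26: "unimodular_in config_vec A26 ((hull) convex ` faces26)"
  unfolding unimodular_in_def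
proof (intro ballI impI)
  fix S assume "S \<in> (hull) convex ` faces26" and max: "\<forall>S'\<in>(hull) convex ` faces26. S \<subseteq> S' \<longrightarrow> S' = S"
  then obtain S0 where S0: "S0 \<in> faces26" "S = convex hull S0" by blast
  obtain M where M: "max_cell M" "S0 \<subseteq> M" using ex_max_cell_superset[OF S0(1)] by blast
  have "convex hull M = S"
    using max max_cell_mem_faces26[OF M(1)] hull_mono[OF M(2)] S0(2) by blast
  then have "vertices S = M"
    using A26.vertices_convex_hull_simplex[OF max_cell_mem_faces26[OF M(1)]] by simp
  then show "lattice_basis (config_vec ` vertices S) (config_vec ` A26)"
    using max_cell_lattice_basis[OF M(1)] by simp
qed

theorem theorem3p4:
  shows "(\<exists>\<T>. triangulation_of A26 \<T> \<and> T_prism \<subseteq> \<T>) \<and>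
         (\<exists>\<T>. triangulation_of A26 \<T> \<and> T_prism \<subseteq> \<T> \<and> unimodular_in config_vec A26 \<T>)"
  using triangulation_faces26 T_prism_subset unimodular_faces26 by blast

end
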